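(* Let $T$ be a circle map $T(x)=x(1+V(x)) \bmod 1$ as described in the context. Let $\omega$ and $\Omega$ be moduli of continuity such that $\Omega$ is $T$-compatible with respect to $\omega$, and assume that $\Omega$ is concave and vanishes orderly. Let $f\in\mathscr C_\omega(\mathbb T)$ and let $d\mu=h\,d\nu$ be the associated equilibrium state. Then for any function $\phi\in\mathscr C_\Omega(\mathbb T)$ which is not cohomologous to a constant, there is $\gamma=\gamma(\phi)>0$ such that, for every $b\in\mathbb R$, $$\lim_{n\to\infty}\mu\Big\{x\in\mathbb T:\frac1{\sqrt n}S_n\Big(\phi-\int\phi\,d\mu\Big)(x)<b\Big\}=\frac1{\gamma\sqrt{2\pi}}\int_{-\infty}^b e^{-t^2/2\gamma^2}\,dt,$$ where $S_n\phi=\phi+\phi\circ T+\cdots+\phi\circ T^{n-1}$.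
   Context: Phase space and dynamics: $\mathbb T=[0,1)$ is the circle with metric $d(x,y)=\min\{|x-y|,|x-y\pm1|\}$. $T:\mathbb T\to\mathbb T$ is the continuous map $T(x)=x(1+V(x)) \bmod 1$, where $V:[0,\infty)\to[0,\infty)$ is continuous and increasing, $V(1)$ is a positive integer, and $V$ is regularly varying at $0$: there is $\sigma\ge0$ with $\lim_{x\to0}V(tx)/V(x)=t^\sigma$ for all $t>0$. Moduli of continuity: a modulus of continuity is a continuous non-decreasing function $\omega:[0,\infty)\to[0,\infty)$ with $\omega(0)=0$ (and $\omega(t)>0$ for $t>0$, so that the quotients below make sense). $|f|_\omega:=\sup_{x\ne y}|f(x)-f(y)|/\omega(d(x,y))$, and $\mathscr C_\omega(\mathbb T)$ is the space of real-valued continuous functions $f$ on $\mathbb T$ with $|f|_\omega<\infty$. $T$-compatibility: a pre-orbit of $x_0$ is a sequence $\{x_k\}_{k\ge0}$ with $T(x_{k+1})=x_k$ for all $k$. $\Omega$ is $T$-compatible with respect to $\omega$ if there are constants $\varrho_1,C_1>0$ such that, for any $x_0,y_0$ with $d(x_0,y_0)<\varrho_1$, there is a bijection between the pre-orbits $\{x_k\}$ of $x_0$ and the pre-orbits $\{y_k\}$ of $y_0$ such that corresponding pre-orbits satisfy, for all $k$, $d(x_k,y_k)\le d(x_0,y_0)<\varrho_1$ and $C_1\sum_{j=1}^k\omega(d(x_j,y_j))\le\Omega(d(x_0,y_0))-\Omega(d(x_k,y_k))$. $\Omega$ vanishes orderly if $\lim_{x\to0^+}\sup_{0<\mathsf d<1/2}\Omega(\mathsf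 d x)/\Omega(\mathsf d)=0$. Transfer operator and equilibrium state: $\mathscr L_f\phi(x)=\sum_{y\in T^{-1}(x)}e^{f(y)}\phi(y)$. Known fact (Ruelle-Perron-Frobenius theorem from earlier work): if $\Omega$ is $T$-compatible with respect to $\omega$ and $f\in\mathscr C_\omega(\mathbb T)$, there are $\chi>0$ (the maximal eigenvalue), a strictly positive $h\in\mathscr C_\Omega(\mathbb T)$ and a Borel probability measure $\nu$ with $\mathscr L_fh=\chi h$, $\mathscr L_f^*\nu=\chi\nu$, $\int h\,d\nu=1$, and $\chi^{-n}\mathscr L_f^n\psi\to h\int\psi\,d\nu$ uniformly for every continuous $\psi$. The $T$-invariant probability $d\mu=h\,d\nu$ is the unique equilibrium state of $f$, i.e. the unique $T$-invariant Borel probability $m$ maximizing $h_m(T)+\int f\,dm$, where $h_m(T)$ is the Kolmogorov-Sinai entropy; $\mu$ gives positive mass to every nonempty open set. Cohomology: $\phi$ is cohomologous to a constant if $\phi=u-u\circ T+c$ for some continuous $u:\mathbb T\to\mathbb R$ and some constant $c\in\mathbb R$. *)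

theory Defs
  imports "HOL-Probability.Probability"
begin

section \<open>The circle\<close>

typedef circle = "{0..<1::real}"
  morphisms coord circle_of
  by (rule exI[of _ 0]) simp

instantiation circle :: metric_space
begin

definition dist_circle :: "circle \<Rightarrow> circle \<Rightarrow> real" where
  "dist_circle x y =
     Min {\<bar>coord x - coord y\<bar>, \<bar>coord x - coord y + 1\<bar>, \<bar>coord x - coord y - 1\<bar>}"

definition uniformity_circle :: "(circle \<times> circle) filter" where
  "uniformity_circle = (INF e\<in>{0<..}. principal {(x, y). dist x y < e})"

definition open_circle :: "circle set \<Rightarrow> bool" where
  "open_circle U \<longleftrightarrow> (\<forall>x\<in>U. \<forall>\<^sub>F (x', y) in uniformity. x' = x \<longrightarrow> y \<in> U)"

instance
proof
  fix x y z :: circle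
  have range: "0 \<le> coord a" "coord a < 1" for a
    using coord[of a] by auto
  show "(dist x y = 0) = (x = y)"
    using range[of x] range[of y] coord_inject[of x y]
    by (auto simp: dist_circle_def min_def)
  show "dist x y \<le> dist x z + dist y z"
    using range[of x] range[of y] range[of z]
    by (simp add: dist_circle_def)
qed (auto simp: uniformity_circle_def open_circle_def)

end


section \<open>The map and the moduli of continuity\<close>

definition regularly_varying_at_0 :: "(real \<Rightarrow> real) \<Rightarrow> bool" where
  "regularly_varying_at_0 V \<longleftrightarrow>
     (\<exists>\<sigma>\<ge>0. \<forall>t>0. ((\<lambda>x. V (t * x) / V x) \<longlongrightarrow> t powr \<sigma>) (at_right 0))"

text \<open>Only the values of \<open>V\<close> on \<open>[0, \<infinity>)\<close> matter. Monotonicity is not required to be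
  strict; \<open>x (1 + V x)\<close> is strictly increasing in any case.\<close>

definition admissible :: "(real \<Rightarrow> real) \<Rightarrow> bool" where
  "admissible V \<longleftrightarrow>
     continuous_on {0..} V \<and> mono_on {0..} V \<and> (\<forall>x\<ge>0. V x \<ge> 0) \<and>
     (\<exists>p::nat. p > 0 \<and> V 1 = real p) \<and> regularly_varying_at_0 V"

definition circle_map :: "(real \<Rightarrow> real) \<Rightarrow> circle \<Rightarrow> circle" where
  "circle_map V x = circle_of (frac (coord x * (1 + V (coord x))))"

definition modulus :: "(real \<Rightarrow> real) \<Rightarrow> bool" where
  "modulus \<omega> \<longleftrightarrow>
     continuous_on {0..} \<omega> \<and> mono_on {0..} \<omega> \<and> \<omega> 0 = 0 \<and> (\<forall>t>0. \<omega> t > 0)"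

definition modulus_seminorm :: "(real \<Rightarrow> real) \<Rightarrow> (circle \<Rightarrow> real) \<Rightarrow> ereal" where
  "modulus_seminorm \<omega> f =
     (SUP (x, y)\<in>{(x, y). x \<noteq> y}. ereal (\<bar>f x - f y\<bar> / \<omega> (dist x y)))"

definition C_mod :: "(real \<Rightarrow> real) \<Rightarrow> (circle \<Rightarrow> real) set" where
  "C_mod \<omega> = {f. continuous_on UNIV f \<and> modulus_seminorm \<omega> f < \<infinity>}"

definition pre_orbits :: "('a \<Rightarrow> 'a) \<Rightarrow> 'a \<Rightarrow> (nat \<Rightarrow> 'a) set" where
  "pre_orbits T x0 = {x. x 0 = x0 \<and> (\<forall>k. T (x (Suc k)) = x k)}"

definition compatible ::
  "(circle \<Rightarrow> circle) \<Rightarrow> (real \<Rightarrow> real) \<Rightarrow> (real \<Rightarrow> real) \<Rightarrow> bool" where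
  "compatible T \<Omega> \<omega> \<longleftrightarrow>
     (\<exists>\<rho>>0. \<exists>C>0. \<forall>x0 y0. dist x0 y0 < \<rho> \<longrightarrow>
        (\<exists>B. bij_betw B (pre_orbits T x0) (pre_orbits T y0) \<and>
          (\<forall>x\<in>pre_orbits T x0. \<forall>k.
             dist (x k) (B x k) \<le> dist x0 y0 \<and>
             C * (\<Sum>j=1..k. \<omega> (dist (x j) (B x j)))
               \<le> \<Omega> (dist x0 y0) - \<Omega> (dist (x k) (B x k)))))"

text \<open>For \<open>0 < x \<le> 1\<close> and a modulus \<open>\<Omega>\<close> the quotients lie in \<open>[0, 1]\<close>,
  so the real supremum is a genuine one near \<open>0\<close>.\<close>

definition vanishes_orderly :: "(real \<Rightarrow> real) \<Rightarrow> bool" where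
  "vanishes_orderly \<Omega> \<longleftrightarrow>
     ((\<lambda>x. SUP d\<in>{0<..<1/2}. \<Omega> (d * x) / \<Omega> d) \<longlongrightarrow> 0) (at_right 0)"


section \<open>Transfer operator and equilibrium states\<close>

text \<open>For the maps considered here every point \<open>x\<close> has exactly \<open>V 1 + 1\<close> preimages,
  so the sum is over a finite set.\<close>

definition transfer_op ::
  "(circle \<Rightarrow> circle) \<Rightarrow> (circle \<Rightarrow> real) \<Rightarrow> (circle \<Rightarrow> real) \<Rightarrow> circle \<Rightarrow> real" where
  "transfer_op T f \<phi> x = (\<Sum>y\<in>T -` {x}. exp (f y) * \<phi> y)"

text \<open>The data provided by the Ruelle--Perron--Frobenius theorem. The equation
  for the dual operator is tested on continuous functions.\<close>

definition RPF_data ::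
  "(circle \<Rightarrow> circle) \<Rightarrow> (circle \<Rightarrow> real) \<Rightarrow> (real \<Rightarrow> real)
     \<Rightarrow> real \<Rightarrow> (circle \<Rightarrow> real) \<Rightarrow> circle measure \<Rightarrow> bool" where
  "RPF_data T f \<Omega> \<kappa> h \<nu> \<longleftrightarrow>
     \<kappa> > 0 \<and> h \<in> C_mod \<Omega> \<and> (\<forall>x. h x > 0) \<and>
     prob_space \<nu> \<and> sets \<nu> = sets borel \<and>
     transfer_op T f h = (\<lambda>x. \<kappa> * h x) \<and>
     (\<forall>\<psi>. continuous_on UNIV \<psi> \<longrightarrow>
        (\<integral>x. transfer_op T f \<psi> x \<partial>\<nu>) = \<kappa> * (\<integral>x. \<psi> x \<partial>\<nu>)) \<and>
     (\<integral>x. h x \<partial>\<nu>) = 1 \<and>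
     (\<forall>\<psi>. continuous_on UNIV \<psi> \<longrightarrow>
        uniform_limit UNIV (\<lambda>n x. (transfer_op T f ^^ n) \<psi> x / \<kappa> ^ n)
          (\<lambda>x. h x * (\<integral>y. \<psi> y \<partial>\<nu>)) sequentially)"

definition finite_partition :: "'a measure \<Rightarrow> 'a set set \<Rightarrow> bool" where
  "finite_partition m P \<longleftrightarrow> finite P \<and> P \<subseteq> sets m \<and> partition_on (space m) P"

text \<open>The join of the partitions \<open>T\<^sup>-\<^sup>i P\<close> for \<open>i < n\<close>. It may also contain the
  empty set, which does not contribute to the entropy since \<open>0 * ln 0 = 0\<close>.\<close>

definition dynamical_join ::
  "'a measure \<Rightarrow> ('a \<Rightarrow> 'a) \<Rightarrow> 'a set set \<Rightarrow> nat \<Rightarrow> 'a set set" where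
  "dynamical_join m T P n =
     {space m \<inter> (\<Inter>i<n. (T ^^ i) -` A i) | A. \<forall>i<n. A i \<in> P}"

definition partition_entropy :: "'a measure \<Rightarrow> 'a set set \<Rightarrow> real" where
  "partition_entropy m P = - (\<Sum>A\<in>P. measure m A * ln (measure m A))"

text \<open>Kolmogorov--Sinai entropy; for a measure-preserving \<open>T\<close> the limit exists by
  subadditivity.\<close>

definition KS_entropy :: "'a measure \<Rightarrow> ('a \<Rightarrow> 'a) \<Rightarrow> ereal" where
  "KS_entropy m T =
     (SUP P\<in>{P. finite_partition m P}.
        ereal (lim (\<lambda>n. partition_entropy m (dynamical_join m T P n) / real n)))"

definition invariant_prob :: "(circle \<Rightarrow> circle) \<Rightarrow> circle measure \<Rightarrow> bool" where
  "invariant_prob T m \<longleftrightarrow>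
     prob_space m \<and> sets m = sets borel \<and> T \<in> measurable m m \<and> distr m m T = m"

definition equilibrium_state ::
  "(circle \<Rightarrow> circle) \<Rightarrow> (circle \<Rightarrow> real) \<Rightarrow> circle measure \<Rightarrow> bool" where
  "equilibrium_state T f \<mu> \<longleftrightarrow>
     invariant_prob T \<mu> \<and>
     (\<forall>m. invariant_prob T m \<longrightarrow>
        KS_entropy m T + ereal (\<integral>x. f x \<partial>m) \<le> KS_entropy \<mu> T + ereal (\<integral>x. f x \<partial>\<mu>))"


section \<open>Birkhoff sums and cohomology\<close>

definition birkhoff_sum :: "('a \<Rightarrow> 'a) \<Rightarrow> ('a \<Rightarrow> real) \<Rightarrow> nat \<Rightarrow> 'a \<Rightarrow> real" where
  "birkhoff_sum T \<phi> n x = (\<Sum>k<n. \<phi> ((T ^^ k) x))"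

definition cohomologous_to_constant :: "(circle \<Rightarrow> circle) \<Rightarrow> (circle \<Rightarrow> real) \<Rightarrow> bool" where
  "cohomologous_to_constant T \<phi> \<longleftrightarrow>
     (\<exists>u c. continuous_on UNIV u \<and> (\<forall>x. \<phi> x = u x - u (T x) + c))"

end

theory Submission
  imports Defs
begin

text \<open>Normalise the transfer operator by \<open>L a = \<L>\<^sub>f (h a) / (\<kappa> h)\<close>, so that \<open>L 1 = 1\<close> and \<open>L\<close> is dual to
  composition with \<open>T\<close> with respect to \<open>\<mu>\<close>. Every point has a preimage away from the fixed point \<open>0\<close>,
  at which the inverse branch contracts uniformly; as \<open>\<Omega>\<close> is concave and vanishes orderly, this branch
  contracts \<open>\<Omega>\<close> by a factor, and compatibility bounds the oscillation of the weights by \<open>\<Omega>\<close>. The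
  resulting Lasota--Yorke inequality and the uniform convergence \<open>L\<^sup>n a \<rightarrow> \<integral> a d\<mu>\<close> give exponential
  decay, so \<open>u = \<Sum>\<^sub>n L\<^sup>n (\<phi> - \<integral> \<phi> d\<mu>)\<close>, summed over \<open>n \<ge> 1\<close>, converges uniformly and
  \<open>\<psi> = \<phi> - \<integral> \<phi> d\<mu> + u - u \<circ> T\<close> satisfies \<open>L \<psi> = 0\<close> (Gordin).

  For such \<open>\<psi>\<close> the characteristic function of \<open>S\<^sub>n \<psi>\<close> at \<open>s\<close> is multiplied by
  \<open>1 - s\<^sup>2 \<gamma>\<^sup>2 / 2\<close>, up to a small error, when \<open>n\<close> grows by one, where \<open>\<gamma>\<^sup>2 = \<integral> \<psi>\<^sup>2 d\<mu>\<close>, and Levy's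
  theorem applies. If \<open>\<gamma> = 0\<close> then \<open>\<psi> = 0\<close>, since \<open>\<mu>\<close> has full support, and \<open>\<phi>\<close> is cohomologous to
  a constant.\<close>

section \<open>The circle and lifts of expanding maps\<close>

definition proj :: "real \<Rightarrow> circle" where
  "proj t = circle_of (frac t)"

lemma coord_range: "0 \<le> coord x" "coord x < 1"
  using coord[of x] by auto

lemma coord_proj: "coord (proj t) = frac t"
  unfolding proj_def by (rule circle_of_inverse) (simp add: frac_lt_1)

lemma proj_coord: "proj (coord x) = x"
  using coord_range[of x] by (simp add: proj_def frac_eq coord_inverse)

lemma proj_eq_iff: "proj s = proj t \<longleftrightarrow> s - t \<in> \<int>"
proof
  assume "proj s = proj t"
  then have "frac s = frac t" by (metis coord_proj)
  then have "s - t = of_int (\<lfloor>s\<rfloor> - \<lfloor>t\<rfloor>)" by (simp add: frac_def)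
  then show "s - t \<in> \<int>" by (metis Ints_of_int)
next
  assume "s - t \<in> \<int>"
  then obtain k where "s - t = of_int k" by (elim Ints_cases)
  then have "s = t + of_int k" by simp
  then have "frac s = frac t" by (simp add: frac_def)
  then show "proj s = proj t" by (simp add: proj_def)
qed

lemma proj_add_of_int: "proj (t + of_int k) = proj t"
  by (simp add: proj_eq_iff)

text \<open>The fractional parts differ by a number in (-1, 1), so among all integer translates of
  this difference one by -1, 0 or 1 is shortest. Hence the minimum of three terms is the quotient
  metric.\<close>

lemma dist_proj_le_int: "dist (proj s) (proj t) \<le> \<bar>s - t + of_int k\<bar>"
proof -
  define a where "a = frac s" 
  define b where "b = frac t"
  define m where "m = \<lfloor>s\<rfloor> - \<lfloor>t\<rfloor> + k"
  have ab: "0 \<le> a" "a < 1" "0 \<le> b" "b < 1" by (auto simp: a_def b_def frac_lt_1)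
  have "s - t + of_int k = a - b + of_int m" by (simp add: a_def b_def m_def frac_def)
  moreover have "Min {\<bar>a - b\<bar>, \<bar>a - b + 1\<bar>, \<bar>a - b - 1\<bar>} \<le> \<bar>a - b + of_int m\<bar>"
  proof -
    consider "m = 0" | "m \<ge> 1" | "m \<le> -1" by linarith
    then show ?thesis
    proof cases
      case 2
      then have "real_of_int m \<ge> 1" by simp
      then show ?thesis using ab by simp
    next
      case 3
      then have "real_of_int m \<le> -1" by linarith
      then show ?thesis using ab by simp
    qed simp
  qed
  ultimately show ?thesis by (simp add: dist_circle_def coord_proj a_def b_def)
qed

lemma dist_proj_le: "dist (proj s) (proj t) \<le> \<bar>s - t\<bar>"
  using dist_proj_le_int[of s t 0] by simp

text \<open>The minimum defining the distance is attained, and the translate attaining it selects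
  the lift of \<open>y\<close>. This replaces circle distances by differences of reals.\<close>

lemma ex_lift_dist:
  obtains s where "proj s = y" "\<bar>s - t\<bar> = dist (proj t) y"
proof -
  define c where "c = coord y - frac t"
  have "dist (proj t) y = Min {\<bar>c\<bar>, \<bar>c - 1\<bar>, \<bar>c + 1\<bar>}"
    unfolding dist_circle_def coord_proj c_def
    by (intro arg_cong[where f=Min]) (simp add: abs_minus_commute algebra_simps insert_commute)
  then have "dist (proj t) y \<in> {\<bar>c\<bar>, \<bar>c - 1\<bar>, \<bar>c + 1\<bar>}"
    by (metis Min_in finite.intros insert_not_empty)
  then obtain k :: int where k: "dist (proj t) y = \<bar>c + of_int k\<bar>"
    by (metis add.right_neutral diff_conv_add_uminus insertE of_int_0 of_int_1 of_int_minus singletonD)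
  show ?thesis
  proof (rule that[of "coord y + of_int (k + \<lfloor>t\<rfloor>)"])
    show "proj (coord y + of_int (k + \<lfloor>t\<rfloor>)) = y" by (simp only: proj_add_of_int proj_coord)
    show "\<bar>coord y + of_int (k + \<lfloor>t\<rfloor>) - t\<bar> = dist (proj t) y"
      using k by (simp add: c_def frac_def algebra_simps)
  qed
qed

lemma dist_proj_eq:
  assumes "\<bar>s - t\<bar> \<le> 1/2" shows "dist (proj s) (proj t) = \<bar>s - t\<bar>"
proof (rule antisym[OF dist_proj_le])
  obtain r where r: "proj r = proj s" "\<bar>r - t\<bar> = dist (proj t) (proj s)"
    using ex_lift_dist .
  obtain k where "r - s = of_int k" using r(1) by (auto simp: proj_eq_iff elim: Ints_cases)
  then have "r - t = s - t + of_int k" by simp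
  moreover have "\<bar>s - t\<bar> \<le> \<bar>s - t + of_int k\<bar>"
  proof (cases "k = 0")
    case False
    then have "\<bar>real_of_int k\<bar> \<ge> 1" by linarith
    then show ?thesis using assms by linarith
  qed simp
  ultimately show "\<bar>s - t\<bar> \<le> dist (proj s) (proj t)" using r(2) by (simp add: dist_commute)
qed

lemma continuous_on_proj: "continuous_on S proj"
  unfolding continuous_on_iff
  by (metis dist_proj_le dist_real_def le_less_trans)

lemma proj_image_unit: "proj ` {0..1} = UNIV"
  by (metis UNIV_eq_I atLeastAtMost_iff coord_range imageI less_imp_le proj_coord)

lemma compact_circle: "compact (UNIV :: circle set)"
  by (metis compact_Icc compact_continuous_image continuous_on_proj proj_image_unit)

text \<open>A point near \<open>x\<close> has a lift equally near \<open>coord x\<close>, so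
  continuity of the periodic lift descends to the quotient, also across the base point 0.\<close>

lemma continuous_on_circle:
  fixes f :: "circle \<Rightarrow> 'b::metric_space"
  assumes "continuous_on UNIV (\<lambda>t. f (proj t))"
  shows "continuous_on UNIV f"
  unfolding continuous_on_iff
proof (intro ballI allI impI)
  fix x e assume "(0::real) < e"
  then obtain d where d: "d > 0" "\<And>t. dist t (coord x) < d \<Longrightarrow> dist (f (proj t)) (f x) < e"
    using assms[unfolded continuous_on_iff, rule_format, of "coord x" e] by (auto simp: proj_coord)
  have "dist (f y) (f x) < e" if y: "dist y x < d" for y
  proof -
    obtain s where "proj s = y" "\<bar>s - coord x\<bar> = dist (proj (coord x)) y" using ex_lift_dist .
    then show ?thesis using d(2)[of s] y by (auto simp: proj_coord dist_real_def dist_commute)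
  qed
  with d(1) show "\<exists>d>0. \<forall>y\<in>UNIV. dist y x < d \<longrightarrow> dist (f y) (f x) < e" by blast
qed

text \<open>\<open>G\<close> is a lift of \<open>T\<close> of degree \<open>q\<close>. Since 0 may
  be a neutral fixed point, \<open>G_expand\<close> is strict but carries no uniform factor;
  \<open>G_middle\<close> supplies one on each interval [c, 1] with c > 0.\<close>

locale circle_lift =
  fixes G :: "real \<Rightarrow> real" and T :: "circle \<Rightarrow> circle" and q :: nat
  assumes cont_G: "continuous_on UNIV G"
    and G_expand: "x < y \<Longrightarrow> y - x < G y - G x"
    and G_0: "G 0 = 0"
    and G_shift: "G (t + 1) = G t + real q"
    and q_ge_2: "2 \<le> q"
    and T_proj: "T (proj t) = proj (G t)"
    and G_middle: "0 < c \<Longrightarrow> \<exists>\<Lambda>>1. \<forall>x\<in>{c..1}. \<forall>y\<in>{c..1}. x \<le> y \<longrightarrow> \<Lambda> * (y - x) \<le> G y - G x"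
begin

lemma G_expand_abs: "x \<noteq> y \<Longrightarrow> \<bar>x - y\<bar> < \<bar>G x - G y\<bar>"
  using G_expand[of x y] G_expand[of y x] by (auto simp: abs_if)

lemma G_expand_le: "\<bar>x - y\<bar> \<le> \<bar>G x - G y\<bar>"
  using G_expand_abs[of x y] by (cases "x = y") auto

lemma strict_mono_G: "strict_mono G"
  using G_expand by (intro strict_monoI) (smt (verit))

lemma inj_G: "inj G"
  using strict_mono_G by (rule strict_mono_imp_inj_on)

lemma surj_G: "surj G"
proof -
  have "\<exists>x. G x = y" for y
  proof -
    have "G (- \<bar>y\<bar>) \<le> y" "y \<le> G \<bar>y\<bar>"
      using G_expand[of "-\<bar>y\<bar>" 0] G_expand[of 0 "\<bar>y\<bar>"] G_0 by (cases "y = 0"; auto)+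
    moreover have "continuous_on {-\<bar>y\<bar>..\<bar>y\<bar>} G" using cont_G continuous_on_subset by blast
    ultimately show ?thesis using IVT'[of G "-\<bar>y\<bar>" y "\<bar>y\<bar>"] by auto
  qed
  then show ?thesis by (metis surjI)
qed

section \<open>The inverse of the lift and the inverse branches\<close>

definition H :: "real \<Rightarrow> real" where "H = inv G"

lemma G_H: "G (H t) = t"
  unfolding H_def by (rule surj_f_inv_f[OF surj_G])

lemma H_G: "H (G t) = t"
  unfolding H_def by (rule inv_f_f[OF inj_G])

lemma H_contract: "\<bar>H s - H t\<bar> \<le> \<bar>s - t\<bar>"
  using G_expand_le[of "H s" "H t"] by (simp add: G_H)

lemma H_contract_strict: "s \<noteq> t \<Longrightarrow> \<bar>H s - H t\<bar> < \<bar>s - t\<bar>"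
  using G_expand_abs[of "H s" "H t"] by (metis G_H)

lemma G_shift_int: "G (t + of_int k) = G t + real q * of_int k"
proof -
  have n: "G (t + of_nat n) = G t + real q * of_nat n" for t n
  proof (induction n)
    case (Suc n)
    show ?case using Suc G_shift[of "t + real n"] by (simp add: algebra_simps)
  qed simp
  show ?thesis
  proof (cases "k \<ge> 0")
    case True
    then show ?thesis using n[of t "nat k"] by simp
  next
    case False
    then show ?thesis using n[of "t + of_int k" "nat (-k)"] by (simp add: algebra_simps)
  qed
qed

lemma H_shift_int: "H (t + real q * of_int k) = H t + of_int k"
  by (metis G_H G_shift_int H_G)

text \<open>Inverse branches are functions of a real lift, not of a circle point: moving
  \<open>t\<close> once around the circle turns branch \<open>j\<close> into branch
  \<open>j + 1\<close>.\<close>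

definition branch :: "nat \<Rightarrow> real \<Rightarrow> circle" where
  "branch j t = proj (H (t + real j))"

lemma T_branch: "T (branch j t) = proj t"
  using proj_add_of_int[of t "int j"] by (simp add: branch_def T_proj G_H)

lemma preimages_eq: "T -` {proj t} = (\<lambda>j. branch j t) ` {..<q}"
proof (intro equalityI subsetI)
  fix y assume "y \<in> T -` {proj t}"
  then have "proj (G (coord y)) = proj t" by (metis T_proj proj_coord vimage_singleton_eq)
  then obtain k where k: "G (coord y) = t + of_int k"
    by (auto simp: proj_eq_iff elim!: Ints_cases) (metis add.commute diff_add_cancel)
  \<comment> \<open>Only the residue of \<open>k\<close> modulo \<open>q\<close> matters: the
    quotient shifts \<open>H\<close> by an integer, which \<open>proj\<close> forgets.\<close>
  define j where "j = nat (k mod int q)"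
  have q0: "int q > 0" using q_ge_2 by simp
  have j: "j < q" "k = int j + int q * (k div int q)"
    using q0 by (auto simp: j_def nat_less_iff pos_mod_bound)
  have "real_of_int k = real j + real q * of_int (k div int q)"
    using arg_cong[OF j(2), of real_of_int] by simp
  then have "coord y = H ((t + real j) + real q * of_int (k div int q))"
    using k by (metis H_G add.assoc)
  then have "y = branch j t"
    by (metis H_shift_int branch_def proj_add_of_int proj_coord)
  with j(1) show "y \<in> (\<lambda>j. branch j t) ` {..<q}" by blast
qed (auto simp: T_branch)

lemma inj_on_branch: "inj_on (\<lambda>j. branch j t) {..<q}"
proof (rule inj_onI)
  fix i j assume ij: "i \<in> {..<q}" "j \<in> {..<q}" "branch i t = branch j t"
  then obtain k where "H (t + real i) = H (t + real j) + of_int k"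
    by (auto simp: branch_def proj_eq_iff elim!: Ints_cases) (metis add.commute diff_add_cancel)
  then have "t + real i = t + real j + real q * of_int k"
    by (metis G_H G_shift_int)
  then have "real_of_int (int i) = of_int (int j + int q * k)" by simp
  then have "int i = int j + int q * k" by (simp only: of_int_eq_iff)
  then have "int i mod int q = int j mod int q" by simp
  then show "i = j" using ij by simp
qed

lemma sum_preimages: "(\<Sum>y\<in>T -` {proj t}. a y) = (\<Sum>j<q. a (branch j t))"
  unfolding preimages_eq by (rule sum.reindex[OF inj_on_branch, simplified comp_def])

lemma dist_branch_le: "dist (branch j s) (branch j t) \<le> \<bar>s - t\<bar>"
  using dist_proj_le[of "H (s + real j)" "H (t + real j)"] H_contract[of "s + real j" "t + real j"]
  by (simp add: branch_def)

lemma continuous_on_branch: "continuous_on S (branch j)"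
  unfolding continuous_on_iff by (metis dist_branch_le dist_real_def le_less_trans)

lemma cont_T: "continuous_on UNIV T"
proof (rule continuous_on_circle)
  show "continuous_on UNIV (\<lambda>t. T (proj t))"
    unfolding T_proj using cont_G continuous_on_compose2[OF continuous_on_proj] by blast
qed

lemma surj_T: "surj T"
  by (rule surjI[of T "\<lambda>y. branch 0 (coord y)"]) (simp add: T_branch proj_coord)

text \<open>Lift \<open>s\<close> as close as possible to \<open>G (coord x)\<close> and apply
  \<open>H\<close>, which strictly shortens distances. No rate is available near the fixed point,
  but strictness suffices for the farthest-point argument in
  \<open>zero_if_integral_zero\<close>.\<close>

lemma preimage_closer:
  assumes "s \<noteq> T x" obtains y where "T y = s" "dist x y < dist (T x) s"
proof -
  have Tx: "T x = proj (G (coord x))" by (metis T_proj proj_coord)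
  obtain r where r: "proj r = s" "\<bar>r - G (coord x)\<bar> = dist (T x) s"
    unfolding Tx using ex_lift_dist .
  have "r \<noteq> G (coord x)" using assms r Tx by auto
  then have "\<bar>H r - coord x\<bar> < dist (T x) s"
    using H_contract_strict[of r "G (coord x)"] r(2) by (simp add: H_G)
  then have "dist x (proj (H r)) < dist (T x) s"
    using dist_proj_le[of "H r" "coord x"] by (simp add: proj_coord dist_commute)
  then show ?thesis using that[of "proj (H r)"] r(1) by (simp add: T_proj G_H)
qed

lemma G_uniform:
  assumes "e > 0" obtains d where "d > 0" "\<And>a s. \<lbrakk>0 \<le> a; a \<le> 1; \<bar>s - a\<bar> < d\<rbrakk> \<Longrightarrow> \<bar>G s - G a\<bar> < e"
proof -
  have "uniformly_continuous_on {-1..2} G"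
    using cont_G by (intro compact_uniformly_continuous) (auto intro: continuous_on_subset)
  then obtain d where d: "d > 0" "\<And>x y. \<lbrakk>x \<in> {-1..2}; y \<in> {-1..2}; dist y x < d\<rbrakk> \<Longrightarrow> dist (G y) (G x) < e"
    using assms unfolding uniformly_continuous_on_def by metis
  show ?thesis
  proof (rule that[of "min d 1"])
    fix a s :: real assume "0 \<le> a" "a \<le> 1" "\<bar>s - a\<bar> < min d 1"
    then have "a \<in> {-1..2}" "s \<in> {-1..2}" "dist s a < d" by (auto simp: dist_real_def abs_less_iff)
    then show "\<bar>G s - G a\<bar> < e" using d(2)[of a s] by (simp add: dist_real_def)
  qed (use d in auto)
qed

text \<open>Lifts of two close points have \<open>G\<close>-images at distance below 1; if the
  points have the same image, these values differ by an integer, hence agree, and \<open>G\<close>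
  is injective.\<close>

lemma preimages_separated:
  obtains \<delta> where "\<delta> > 0" "\<And>x y. \<lbrakk>T x = T y; dist x y < \<delta>\<rbrakk> \<Longrightarrow> x = y"
proof -
  obtain d where d: "d > 0" "\<And>a s. \<lbrakk>0 \<le> a; a \<le> 1; \<bar>s - a\<bar> < d\<rbrakk> \<Longrightarrow> \<bar>G s - G a\<bar> < 1"
    using G_uniform[of 1] by auto
  show ?thesis
  proof (rule that[OF d(1)])
    fix x y assume xy: "T x = T y" "dist x y < d"
    obtain s where s: "proj s = y" "\<bar>s - coord x\<bar> = dist (proj (coord x)) y" using ex_lift_dist .
    then have *: "\<bar>G s - G (coord x)\<bar> < 1" using d(2)[of "coord x" s] xy coord_range[of x]
      by (simp add: proj_coord)
    have "proj (G s) = proj (G (coord x))" by (metis T_proj proj_coord s(1) xy(1))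
    then obtain k where k: "G s - G (coord x) = of_int k" by (auto simp: proj_eq_iff elim: Ints_cases)
    then have "k = 0" using * by linarith
    then have "G s = G (coord x)" using k by simp
    then have "s = coord x" by (metis H_G)
    then show "x = y" using s by (simp add: proj_coord)
  qed
qed

text \<open>Of the preimages under the branches \<open>j = 0\<close> and \<open>j = 1\<close>, one is far from the fixed point \<open>0\<close>,
  where \<open>T\<close> may fail to be uniformly expanding.\<close>

lemma contracting_branch:
  obtains \<eta> \<rho> where "0 < \<eta>" "\<eta> < 1" "\<rho> > 0"
    "\<And>t s. \<lbrakk>0 \<le> t; t < 1; \<bar>s - t\<bar> < \<rho>\<rbrakk> \<Longrightarrow> \<exists>j<q. dist (branch j s) (branch j t) \<le> \<eta> * \<bar>s - t\<bar>"
proof -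
  obtain c0 where c0: "c0 > 0" "\<And>a s. \<lbrakk>0 \<le> a; a \<le> 1; \<bar>s - a\<bar> < c0\<rbrakk> \<Longrightarrow> \<bar>G s - G a\<bar> < 1/4"
    using G_uniform[of "1/4"] by auto
  \<comment> \<open>The choice gives \<open>G c < 1/4\<close> and \<open>G (1 - c) > 7/4\<close>, so
    both ends of the unit interval are controlled.\<close>
  define c where "c = min c0 (1/4) / 2"
  have c: "0 < c" "c < c0" "c < 1/4" using c0(1) by (auto simp: c_def min_def)
  have mono: "H x \<le> H y \<longleftrightarrow> x \<le> y" for x y
    by (metis G_H strict_mono_G strict_mono_less_eq)
  have monoG: "G x \<le> G y \<longleftrightarrow> x \<le> y" for x y by (metis strict_mono_G strict_mono_less_eq)
  have Gc: "G c < 1/4" using c0(2)[of 0 c] c G_0 by simp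
  have G1: "G 1 \<ge> 2" using G_shift[of 0] G_0 q_ge_2 by simp
  have G1c: "G (1 - c) > 7/4" using c0(2)[of 1 "1-c"] c G1 by (simp add: abs_if split: if_splits)
  \<comment> \<open>Expansion is taken from \<open>c/2\<close> on, because the second endpoint may
    lie up to \<open>c/2\<close> below a point of \<open>{c..1 - c}\<close>.\<close>
  obtain \<Lambda> where \<Lambda>: "\<Lambda> > 1" "\<And>x y. \<lbrakk>c/2 \<le> x; y \<le> 1; x \<le> y\<rbrakk> \<Longrightarrow> \<Lambda> * (y - x) \<le> G y - G x"
    using G_middle[of "c/2"] c(1) by auto
  \<comment> \<open>If \<open>H t\<close> lies below \<open>c\<close>, then \<open>t < 1/4\<close>,
    and \<open>t + 1\<close> lies safely between \<open>G c\<close> and \<open>G (1 - c)\<close>;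
    the next branch then avoids the fixed point.\<close>
  have middle: "\<exists>j<q. c \<le> H (t + real j) \<and> H (t + real j) \<le> 1 - c" if t: "0 \<le> t" "t < 1" for t
  proof (cases "c \<le> H t")
    case True
    moreover have "H t \<le> 1 - c" using monoG[of "H t" "1-c"] G1c t by (simp add: G_H)
    ultimately show ?thesis using q_ge_2 by (intro exI[of _ 0]) auto
  next
    case False
    then have "t < 1/4" using monoG[of c "H t"] Gc by (simp add: G_H)
    then have "c \<le> H (t + 1)" "H (t + 1) \<le> 1 - c"
      using monoG[of "H (t+1)" "1-c"] monoG[of c "H (t+1)"] G1c Gc t by (auto simp: G_H)
    then show ?thesis using q_ge_2 by (intro exI[of _ 1]) auto
  qed
  show ?thesis
  proof (rule that[of "1/\<Lambda>" "c/2"])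
    fix t s :: real assume ts: "0 \<le> t" "t < 1" "\<bar>s - t\<bar> < c / 2"
    obtain j where j: "j < q" "c \<le> H (t + real j)" "H (t + real j) \<le> 1 - c" using middle ts by blast
    define x where "x = H (t + real j)"
    define y where "y = H (s + real j)"
    have yx: "\<bar>y - x\<bar> < c / 2" using H_contract[of "s + real j" "t + real j"] ts(3) by (simp add: x_def y_def)
    have x: "c \<le> x" "x \<le> 1 - c" using j by (auto simp: x_def)
    have "\<Lambda> * \<bar>y - x\<bar> \<le> \<bar>G y - G x\<bar>"
      using yx x \<Lambda>(2)[of x y] \<Lambda>(2)[of y x] by (cases "x \<le> y") (auto simp: abs_if)
    also have "\<bar>G y - G x\<bar> = \<bar>s - t\<bar>" by (simp add: x_def y_def G_H)
    finally have "\<bar>y - x\<bar> \<le> 1/\<Lambda> * \<bar>s - t\<bar>" using \<Lambda>(1) by (simp add: field_simps)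
    then have "dist (branch j s) (branch j t) \<le> 1/\<Lambda> * \<bar>s - t\<bar>"
      using dist_proj_le[of y x] by (simp add: branch_def x_def y_def)
    with j show "\<exists>j<q. dist (branch j s) (branch j t) \<le> 1/\<Lambda> * \<bar>s - t\<bar>" by blast
  qed (use \<Lambda> c in auto)
qed

end

section \<open>The central limit theorem for functions in the kernel of a transfer operator\<close>

lemma birkhoff_sum_add: "birkhoff_sum T \<phi> (m + n) x = birkhoff_sum T \<phi> m x + birkhoff_sum T \<phi> n ((T ^^ m) x)"
proof (induction n)
  case (Suc n)
  have "(T ^^ (m + n)) x = (T ^^ n) ((T ^^ m) x)" by (metis add.commute comp_apply funpow_add)
  with Suc show ?case by (simp add: birkhoff_sum_def)
qed (simp add: birkhoff_sum_def)

lemma birkhoff_sum_Suc: "birkhoff_sum T \<phi> (Suc n) x = \<phi> x + birkhoff_sum T \<phi> n (T x)"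
  using birkhoff_sum_add[of T \<phi> 1 n x] by (simp add: birkhoff_sum_def)

lemma birkhoff_sum_coboundary:
  assumes "\<And>x. \<phi> x = \<psi> x - u x + u (T x)"
  shows "birkhoff_sum T \<phi> n x = birkhoff_sum T \<psi> n x - u x + u ((T ^^ n) x)"
  by (induction n) (simp_all add: birkhoff_sum_def assms)

lemma birkhoff_sum_abs_le:
  assumes "\<And>x. \<bar>\<phi> x\<bar> \<le> M" shows "\<bar>birkhoff_sum T \<phi> n x\<bar> \<le> real n * M"
proof -
  have "\<bar>birkhoff_sum T \<phi> n x\<bar> \<le> (\<Sum>k<n. \<bar>\<phi> ((T ^^ k) x)\<bar>)"
    unfolding birkhoff_sum_def by (rule sum_abs)
  also have "\<dots> \<le> (\<Sum>k<n. M)" by (intro sum_mono assms)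
  finally show ?thesis by simp
qed

lemma norm_iexp_minus_1: "norm (iexp x - 1) \<le> \<bar>x\<bar>"
  using iexp_approx1[of x 0] by simp

text \<open>\<open>L\<close> is a Markov operator dual to composition with \<open>T\<close>. The
  convergence \<open>L_mixing\<close> has no rate; a rate is derived later for regular
  functions.\<close>

locale normalized_transfer = prob_space \<mu>
  for \<mu> :: "'a::metric_space measure" +
  fixes T :: "'a \<Rightarrow> 'a" and L :: "('a \<Rightarrow> real) \<Rightarrow> 'a \<Rightarrow> real"
  assumes compact_space: "compact (UNIV :: 'a set)"
    and sets_mu: "sets \<mu> = sets borel"
    and continuous_T: "continuous_on UNIV T"
    and L_add: "L (\<lambda>x. a x + b x) = (\<lambda>x. L a x + L b x)"
    and L_scale: "L (\<lambda>x. c * a x) = (\<lambda>x. c * L a x)"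
    and L_mono: "(\<And>x. a x \<le> b x) \<Longrightarrow> L a x \<le> L b x"
    and L_1: "L (\<lambda>_. 1) = (\<lambda>_. 1)"
    and L_pull: "L (\<lambda>x. a x * b (T x)) = (\<lambda>x. L a x * b x)"
    and continuous_L: "continuous_on UNIV a \<Longrightarrow> continuous_on UNIV (L a)"
    and integral_L: "continuous_on UNIV a \<Longrightarrow> (\<integral>x. L a x \<partial>\<mu>) = (\<integral>x. a x \<partial>\<mu>)"
    and L_mixing: "continuous_on UNIV a \<Longrightarrow>
          uniform_limit UNIV (\<lambda>n. (L ^^ n) a) (\<lambda>_. \<integral>x. a x \<partial>\<mu>) sequentially"
begin

lemma space_mu: "space \<mu> = UNIV"
  using sets_eq_imp_space_eq[OF sets_mu] by simp

lemma measurable_continuous: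
  fixes a :: "'a \<Rightarrow> 'b::topological_space"
  assumes "continuous_on UNIV a" shows "a \<in> borel_measurable \<mu>"
  using borel_measurable_continuous_onI[OF assms] measurable_cong_sets[OF sets_mu refl] by blast

lemma continuous_bounded:
  fixes a :: "'a \<Rightarrow> 'b::real_normed_vector"
  assumes "continuous_on UNIV a"
  obtains M where "M \<ge> 0" "\<And>x. norm (a x) \<le> M"
proof -
  have "bounded (range a)"
    by (rule compact_imp_bounded[OF compact_continuous_image[OF assms compact_space]])
  then show ?thesis using that by (metis bounded_pos less_imp_le rangeI)
qed

lemma integrable_continuous:
  fixes a :: "'a \<Rightarrow> 'b::{banach,second_countable_topology}"
  assumes "continuous_on UNIV a" shows "integrable \<mu> a"
  using continuous_bounded[OF assms]
  by (metis (no_types, lifting) AE_I2 integrable_const_bound measurable_continuous[OF assms])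

lemma norm_integral_le:
  fixes a :: "'a \<Rightarrow> 'b::{banach,second_countable_topology}"
  assumes "continuous_on UNIV a" "\<And>x. norm (a x) \<le> B"
  shows "norm (\<integral>x. a x \<partial>\<mu>) \<le> B"
proof -
  have "norm (\<integral>x. a x \<partial>\<mu>) \<le> (\<integral>x. norm (a x) \<partial>\<mu>)" by (rule integral_norm_bound)
  also have "\<dots> \<le> (\<integral>x. B \<partial>\<mu>)"
    by (intro integral_mono integrable_continuous continuous_intros assms)
  finally show ?thesis by (simp add: prob_space)
qed

section \<open>Iterates of \<open>L\<close> and their duality with composition by
  \<open>T\<close>\<close>

lemma L_const: "L (\<lambda>_. c) = (\<lambda>_. c)"
  using L_scale[of c "\<lambda>_. 1"] by (simp add: L_1)

lemma L_diff: "L (\<lambda>x. a x - b x) = (\<lambda>x. L a x - L b x)"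
  using L_add[of a "\<lambda>x. (-1) * b x"] by (simp only: L_scale) simp

lemma L_abs_le: "(\<And>x. \<bar>a x\<bar> \<le> M) \<Longrightarrow> \<bar>L a x\<bar> \<le> M"
  using L_mono[of a "\<lambda>_. M" x] L_mono[of "\<lambda>_. - M" a x]
  by (simp add: L_const abs_le_iff minus_le_iff)

lemma continuous_Ln: "continuous_on UNIV a \<Longrightarrow> continuous_on UNIV ((L ^^ n) a)"
  by (induction n) (simp_all add: continuous_L)

lemma Ln_add: "(L ^^ n) (\<lambda>x. a x + b x) = (\<lambda>x. (L ^^ n) a x + (L ^^ n) b x)"
  by (induction n) (simp_all add: L_add)

lemma Ln_scale: "(L ^^ n) (\<lambda>x. c * a x) = (\<lambda>x. c * (L ^^ n) a x)"
  by (induction n) (simp_all add: L_scale)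

lemma Ln_0: "(L ^^ n) (\<lambda>_. 0) = (\<lambda>_. 0)"
  by (induction n) (simp_all add: L_const)

lemma Ln_sum: "finite I \<Longrightarrow> (L ^^ n) (\<lambda>x. \<Sum>i\<in>I. a i x) = (\<lambda>x. \<Sum>i\<in>I. (L ^^ n) (a i) x)"
  by (induction I rule: finite_induct) (simp_all add: Ln_add Ln_0)

lemma Ln_abs_le: "(\<And>x. \<bar>a x\<bar> \<le> M) \<Longrightarrow> \<bar>(L ^^ n) a x\<bar> \<le> M"
  by (induction n arbitrary: x) (auto intro: L_abs_le)

lemma integral_Ln: "continuous_on UNIV a \<Longrightarrow> (\<integral>x. (L ^^ n) a x \<partial>\<mu>) = (\<integral>x. a x \<partial>\<mu>)"
  by (induction n) (simp_all add: integral_L continuous_Ln)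

lemma continuous_Tn: "continuous_on UNIV (T ^^ n)"
proof (induction n)
  case (Suc n)
  show ?case using continuous_on_compose2[OF continuous_T Suc] by (simp add: comp_def)
qed (simp add: id_def)

lemma Ln_pull: "(L ^^ n) (\<lambda>x. a x * b ((T ^^ n) x)) = (\<lambda>x. (L ^^ n) a x * b x)"
proof (induction n arbitrary: b)
  case (Suc n)
  have "(L ^^ n) (\<lambda>x. a x * b ((T ^^ Suc n) x)) = (\<lambda>x. (L ^^ n) a x * b (T x))"
    using Suc[of "\<lambda>x. b (T x)"] by simp
  then show ?case by (simp add: L_pull)
qed simp

text \<open>Applying \<open>L ^^ n\<close> under the integral does not change it, and
  \<open>Ln_pull\<close> takes the composed factor out.\<close>

lemma transfer_duality:
  assumes "continuous_on UNIV a" "continuous_on UNIV b"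
  shows "(\<integral>x. a x * b ((T ^^ n) x) \<partial>\<mu>) = (\<integral>x. (L ^^ n) a x * b x \<partial>\<mu>)"
proof -
  have "continuous_on UNIV (\<lambda>x. a x * b ((T ^^ n) x))"
    by (intro continuous_intros assms continuous_on_compose2[OF assms(2) continuous_Tn]) auto
  from integral_Ln[OF this, of n] show ?thesis by (simp add: Ln_pull)
qed

text \<open>\<open>L\<close> acts on real functions only, so the complex factor is treated through
  its real and imaginary parts.\<close>

lemma transfer_duality_complex:
  fixes W :: "'a \<Rightarrow> complex"
  assumes "continuous_on UNIV a" "continuous_on UNIV W"
  shows "(\<integral>x. of_real (a x) * W ((T ^^ n) x) \<partial>\<mu>) = (\<integral>x. of_real ((L ^^ n) a x) * W x \<partial>\<mu>)"
proof -
  have c: "continuous_on UNIV (\<lambda>x. of_real (a x) * W ((T ^^ n) x))"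
    by (intro continuous_intros assms continuous_on_compose2[OF assms(2) continuous_Tn]) auto
  have c': "continuous_on UNIV (\<lambda>x. of_real ((L ^^ n) a x) * W x)"
    by (intro continuous_intros assms continuous_Ln)
  show ?thesis
  proof (rule complex_eqI)
    show "Re (\<integral>x. of_real (a x) * W ((T ^^ n) x) \<partial>\<mu>) = Re (\<integral>x. of_real ((L ^^ n) a x) * W x \<partial>\<mu>)"
      using transfer_duality[OF assms(1) continuous_on_Re[OF assms(2)], of n]
      by (simp flip: integral_Re[OF integrable_continuous[OF c]] integral_Re[OF integrable_continuous[OF c']])
    show "Im (\<integral>x. of_real (a x) * W ((T ^^ n) x) \<partial>\<mu>) = Im (\<integral>x. of_real ((L ^^ n) a x) * W x \<partial>\<mu>)"
      using transfer_duality[OF assms(1) continuous_on_Im[OF assms(2)], of n]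
      by (simp flip: integral_Im[OF integrable_continuous[OF c]] integral_Im[OF integrable_continuous[OF c']])
  qed
qed

lemma continuous_birkhoff_sum:
  assumes "continuous_on UNIV (\<phi> :: 'a \<Rightarrow> real)" shows "continuous_on UNIV (birkhoff_sum T \<phi> n)"
  unfolding birkhoff_sum_def
  by (intro continuous_on_sum continuous_on_compose2[OF assms continuous_Tn]) auto

end

section \<open>Characteristic functions of Birkhoff sums of an element of the kernel of
  \<open>L\<close>\<close>

locale transfer_kernel_element = normalized_transfer \<mu> T L
  for \<mu> :: "'a::metric_space measure" and T L +
  fixes \<psi> :: "'a \<Rightarrow> real"
  assumes continuous_psi: "continuous_on UNIV \<psi>"
    and L_psi: "L \<psi> = (\<lambda>_. 0)"
begin

text \<open>The integral of \<open>W s k\<close> is the characteristic function of the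
  \<open>k\<close>-th Birkhoff sum at \<open>s\<close>.\<close>

definition W :: "real \<Rightarrow> nat \<Rightarrow> 'a \<Rightarrow> complex" where
  "W s k x = iexp (s * birkhoff_sum T \<psi> k x)"

lemma continuous_W: "continuous_on UNIV (W s k)"
  unfolding W_def by (intro continuous_intros continuous_birkhoff_sum continuous_psi)

lemma norm_W: "norm (W s k x) = 1"
  by (simp add: W_def)

lemma W_0: "W s 0 x = 1"
  by (simp add: W_def birkhoff_sum_def)

lemma W_add: "W s (m + k) x = W s m x * W s k ((T ^^ m) x)"
  by (simp add: W_def birkhoff_sum_add ring_distribs exp_add)

lemma W_Suc: "W s (Suc k) x = iexp (s * \<psi> x) * W s k (T x)"
  by (simp add: W_def birkhoff_sum_Suc ring_distribs exp_add)

lemma norm_W_minus_1: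
  assumes "\<And>x. \<bar>\<psi> x\<bar> \<le> M" shows "norm (W s k x - 1) \<le> \<bar>s\<bar> * (real k * M)"
proof -
  have "norm (W s k x - 1) \<le> \<bar>s * birkhoff_sum T \<psi> k x\<bar>"
    unfolding W_def by (rule norm_iexp_minus_1)
  also have "\<dots> \<le> \<bar>s\<bar> * (real k * M)"
    by (simp add: abs_mult mult_left_mono birkhoff_sum_abs_le[OF assms])
  finally show ?thesis .
qed

text \<open>The first \<open>m\<close> terms of the Birkhoff sum are negligible, and the remaining ones are almost
  independent of \<open>c\<close>.\<close>

lemma correlation_bound:
  assumes c: "continuous_on UNIV c" "(\<integral>x. c x \<partial>\<mu>) = 0" "\<And>x. \<bar>c x\<bar> \<le> B"
    and e: "\<And>x. \<bar>(L ^^ m) c x\<bar> \<le> e" and M: "\<And>x. \<bar>\<psi> x\<bar> \<le> M"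
  shows "norm (\<integral>x. of_real (c x) * W s k x \<partial>\<mu>) \<le> B * (\<bar>s\<bar> * (real m * M)) + e"
proof -
  have B0: "B \<ge> 0" and e0: "e \<ge> 0" and M0: "M \<ge> 0"
    using c(3)[of undefined] e[of undefined] M[of undefined] by linarith+
  show ?thesis
  proof (cases "m \<le> k")
    case True
    then obtain l where l: "k = m + l" by (metis le_iff_add)
    \<comment> \<open>\<open>Z\<close> is the error made when \<open>W s m\<close> is replaced by 1;
      in what remains, duality moves \<open>L ^^ m\<close> onto \<open>c\<close>.\<close>
    define Z where "Z x = of_real (c x) * (W s m x - 1) * W s l ((T ^^ m) x)" for x
    have cW: "continuous_on UNIV (\<lambda>x. W s l ((T ^^ m) x))"
      by (rule continuous_on_compose2[OF continuous_W continuous_Tn]) auto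
    have cZ: "continuous_on UNIV Z"
      unfolding Z_def by (intro continuous_intros c continuous_W cW)
    have c2: "continuous_on UNIV (\<lambda>x. of_real (c x) * W s l ((T ^^ m) x))"
      by (intro continuous_intros c cW)
    have "(\<integral>x. of_real (c x) * W s k x \<partial>\<mu>) = (\<integral>x. Z x + of_real (c x) * W s l ((T ^^ m) x) \<partial>\<mu>)"
      unfolding l W_add Z_def by (simp add: algebra_simps)
    also have "\<dots> = (\<integral>x. Z x \<partial>\<mu>) + (\<integral>x. of_real (c x) * W s l ((T ^^ m) x) \<partial>\<mu>)"
      by (intro Bochner_Integration.integral_add integrable_continuous cZ c2)
    also have "(\<integral>x. of_real (c x) * W s l ((T ^^ m) x) \<partial>\<mu>) = (\<integral>x. of_real ((L ^^ m) c x) * W s l x \<partial>\<mu>)"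
      by (rule transfer_duality_complex[OF c(1) continuous_W])
    finally have eq: "(\<integral>x. of_real (c x) * W s k x \<partial>\<mu>) = (\<integral>x. Z x \<partial>\<mu>) + (\<integral>x. of_real ((L ^^ m) c x) * W s l x \<partial>\<mu>)" .
    have "norm (Z x) \<le> B * (\<bar>s\<bar> * (real m * M))" for x
      unfolding Z_def norm_mult norm_W
      using mult_mono[OF c(3) norm_W_minus_1[OF M, of s m x] B0] by simp
    from norm_integral_le[OF cZ this]
    have 1: "norm (\<integral>x. Z x \<partial>\<mu>) \<le> B * (\<bar>s\<bar> * (real m * M))" .
    have "norm (\<integral>x. of_real ((L ^^ m) c x) * W s l x \<partial>\<mu>) \<le> e"
      by (rule norm_integral_le, intro continuous_intros continuous_Ln c continuous_W)
         (simp add: norm_mult norm_W e)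
    with 1 show ?thesis unfolding eq by (rule norm_triangle_mono)
  next
    case False
    \<comment> \<open>Here the whole sum has fewer than \<open>m\<close> terms, so all of
      \<open>W s k\<close> is replaced by 1, and the main term vanishes because \<open>c\<close> has
      mean zero.\<close>
    define Z where "Z x = of_real (c x) * (W s k x - 1)" for x
    have cZ: "continuous_on UNIV Z"
      unfolding Z_def by (intro continuous_intros c continuous_W)
    have c2: "continuous_on UNIV (\<lambda>x. complex_of_real (c x))" by (intro continuous_intros c)
    have "(\<integral>x. of_real (c x) * W s k x \<partial>\<mu>) = (\<integral>x. Z x + of_real (c x) \<partial>\<mu>)"
      by (simp add: Z_def algebra_simps)
    also have "\<dots> = (\<integral>x. Z x \<partial>\<mu>) + (\<integral>x. complex_of_real (c x) \<partial>\<mu>)"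
      by (intro Bochner_Integration.integral_add integrable_continuous cZ c2)
    also have "\<dots> = (\<integral>x. Z x \<partial>\<mu>)" by (simp add: c(2))
    finally have eq: "(\<integral>x. of_real (c x) * W s k x \<partial>\<mu>) = (\<integral>x. Z x \<partial>\<mu>)" .
    have km: "\<bar>s\<bar> * (real k * M) \<le> \<bar>s\<bar> * (real m * M)"
      using False M0 by (intro mult_left_mono mult_right_mono) auto
    have "norm (Z x) \<le> B * (\<bar>s\<bar> * (real m * M))" for x
      unfolding Z_def norm_mult
      using mult_mono[OF c(3) order_trans[OF norm_W_minus_1[OF M, of s k x] km] B0] by simp
    from norm_integral_le[OF cZ this] show ?thesis unfolding eq using e0 by linarith
  qed
qed

definition v :: real where "v = (\<integral>x. (\<psi> x)\<^sup>2 \<partial>\<mu>)"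

text \<open>Expand the first factor of \<open>W s (Suc k)\<close> to second order. The linear term
  drops out because \<open>L \<psi> = 0\<close>; the quadratic term is its mean \<open>v\<close>
  plus the centred function \<open>c\<close>, whose correlation with \<open>W s k\<close> is small
  by \<open>correlation_bound\<close>; the cubic remainder is bounded directly.\<close>

lemma char_step:
  assumes M: "\<And>x. \<bar>\<psi> x\<bar> \<le> M" and e: "\<And>x. \<bar>(L ^^ m) (L (\<lambda>x. (\<psi> x)\<^sup>2 - v)) x\<bar> \<le> e"
  shows "norm ((\<integral>x. W s (Suc k) x \<partial>\<mu>) - of_real (1 - s\<^sup>2 * v / 2) * (\<integral>x. W s k x \<partial>\<mu>))
    \<le> \<bar>s\<bar> ^ 3 * M ^ 3 / 6 + s\<^sup>2 / 2 * (2 * M\<^sup>2 * (\<bar>s\<bar> * (real m * M)) + e)"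
proof -
  have M0: "M \<ge> 0" using M[of undefined] by linarith
  have sq: "(\<psi> x)\<^sup>2 \<le> M\<^sup>2" for x using M[of x] M0 by (simp add: abs_le_square_iff[symmetric])
  have csq: "continuous_on UNIV (\<lambda>x. (\<psi> x)\<^sup>2)" by (intro continuous_intros continuous_psi)
  have v: "0 \<le> v" "v \<le> M\<^sup>2"
    using norm_integral_le[OF csq, of "M\<^sup>2"] sq by (auto simp: v_def intro!: integral_nonneg_AE)
  define c where "c x = (\<psi> x)\<^sup>2 - v" for x
  have cc: "continuous_on UNIV c" unfolding c_def by (intro continuous_intros continuous_psi)
  have cB: "\<bar>c x\<bar> \<le> 2 * M\<^sup>2" for x
    using v sq[of x] zero_le_power2[of "\<psi> x"] unfolding c_def by linarith
  have c0: "(\<integral>x. c x \<partial>\<mu>) = 0"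
    unfolding c_def by (subst Bochner_Integration.integral_diff)
      (auto intro!: integrable_continuous csq simp: v_def prob_space)
  have cWT: "continuous_on UNIV (\<lambda>x. W s k (T x))"
    by (rule continuous_on_compose2[OF continuous_W continuous_T]) auto
  define R where "R x = iexp (s * \<psi> x) - (1 + \<i> * of_real (s * \<psi> x) - of_real (s\<^sup>2 * (\<psi> x)\<^sup>2 / 2))" for x
  have R: "norm (R x) \<le> \<bar>s\<bar> ^ 3 * M ^ 3 / 6" for x
  proof -
    have "(\<Sum>k\<le>2. (\<i> * complex_of_real (s * \<psi> x)) ^ k / fact k)
        = 1 + \<i> * of_real (s * \<psi> x) - of_real (s\<^sup>2 * (\<psi> x)\<^sup>2 / 2)"
      by (simp add: numeral_2_eq_2 power_mult_distrib power2_eq_square algebra_simps)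
    then have "norm (R x) \<le> \<bar>s * \<psi> x\<bar> ^ Suc 2 / fact (Suc 2)"
      unfolding R_def using iexp_approx1[of "s * \<psi> x" 2] by simp
    also have "\<dots> = \<bar>s\<bar> ^ 3 * \<bar>\<psi> x\<bar> ^ 3 / 6"
      unfolding abs_mult power_mult_distrib by (simp add: fact_numeral)
    also have "\<dots> \<le> \<bar>s\<bar> ^ 3 * M ^ 3 / 6"
      by (intro divide_right_mono mult_left_mono power_mono M) auto
    finally show ?thesis .
  qed
  have cR: "continuous_on UNIV R" unfolding R_def by (intro continuous_intros continuous_psi) auto
  have cRW: "continuous_on UNIV (\<lambda>x. R x * W s k (T x))" by (intro continuous_intros cR cWT)
  have cps: "continuous_on UNIV (\<lambda>x. of_real (\<psi> x) * W s k (T x))"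
    by (intro continuous_intros continuous_psi cWT)
  have ccW: "continuous_on UNIV (\<lambda>x. of_real (c x) * W s k (T x))"
    by (intro continuous_intros cc cWT)
  \<comment> \<open>Duality with \<open>n = 1\<close> removes \<open>T\<close>: \<open>L\<close>
    sends 1 to 1, \<open>\<psi>\<close> to 0 and \<open>c\<close> to \<open>L c\<close>.\<close>
  have I1: "(\<integral>x. W s k (T x) \<partial>\<mu>) = (\<integral>x. W s k x \<partial>\<mu>)"
    using transfer_duality_complex[OF continuous_on_const[of _ 1] continuous_W[where s=s and k=k], where n=1] by (simp add: L_1)
  have I2: "(\<integral>x. of_real (\<psi> x) * W s k (T x) \<partial>\<mu>) = 0"
    using transfer_duality_complex[OF continuous_psi continuous_W[where s=s and k=k], where n=1] by (simp add: L_psi)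
  have I3: "(\<integral>x. of_real (c x) * W s k (T x) \<partial>\<mu>) = (\<integral>x. of_real (L c x) * W s k x \<partial>\<mu>)"
    using transfer_duality_complex[OF cc continuous_W[where s=s and k=k], where n=1] by simp
  have "norm (\<integral>x. of_real (L c x) * W s k x \<partial>\<mu>) \<le> 2 * M\<^sup>2 * (\<bar>s\<bar> * (real m * M)) + e"
    by (rule correlation_bound)
      (use e in \<open>auto intro!: continuous_L cc L_abs_le cB M simp: integral_L[OF cc] c0 simp flip: c_def\<close>)
  then have b3: "norm (\<integral>x. of_real (c x) * W s k (T x) \<partial>\<mu>) \<le> 2 * M\<^sup>2 * (\<bar>s\<bar> * (real m * M)) + e"
    by (simp add: I3)
  have bR: "norm (\<integral>x. R x * W s k (T x) \<partial>\<mu>) \<le> \<bar>s\<bar> ^ 3 * M ^ 3 / 6"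
    by (rule norm_integral_le[OF cRW]) (use R in \<open>simp only: norm_mult norm_W mult_1_right\<close>)
  define z where "z = complex_of_real (1 - s\<^sup>2 * v / 2)"
  define w where "w = complex_of_real (s\<^sup>2 / 2)"
  have "(\<integral>x. W s (Suc k) x \<partial>\<mu>) = (\<integral>x. R x * W s k (T x) + z * W s k (T x)
      + (\<i> * of_real s) * (of_real (\<psi> x) * W s k (T x)) - w * (of_real (c x) * W s k (T x)) \<partial>\<mu>)"
    by (rule Bochner_Integration.integral_cong)
      (auto simp: W_Suc R_def z_def w_def c_def field_simps)
  also have "\<dots> = (\<integral>x. R x * W s k (T x) \<partial>\<mu>) + z * (\<integral>x. W s k (T x) \<partial>\<mu>)
      + (\<i> * of_real s) * (\<integral>x. of_real (\<psi> x) * W s k (T x) \<partial>\<mu>) - w * (\<integral>x. of_real (c x) * W s k (T x) \<partial>\<mu>)"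
    using integrable_continuous[OF cRW] integrable_continuous[OF cps] integrable_continuous[OF ccW]
      integrable_continuous[OF cWT]
    by (simp del: of_real_mult)
  finally have eq: "(\<integral>x. W s (Suc k) x \<partial>\<mu>) - z * (\<integral>x. W s k x \<partial>\<mu>)
      = (\<integral>x. R x * W s k (T x) \<partial>\<mu>) - w * (\<integral>x. of_real (c x) * W s k (T x) \<partial>\<mu>)"
    by (simp add: I1 I2)
  have "norm (w * (\<integral>x. of_real (c x) * W s k (T x) \<partial>\<mu>)) \<le> s\<^sup>2 / 2 * (2 * M\<^sup>2 * (\<bar>s\<bar> * (real m * M)) + e)"
    unfolding norm_mult w_def norm_of_real using b3 by (intro mult_mono) auto
  then show ?thesis
    using norm_triangle_ineq4[of "\<integral>x. R x * W s k (T x) \<partial>\<mu>" "w * (\<integral>x. of_real (c x) * W s k (T x) \<partial>\<mu>)"] bR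
    unfolding eq[unfolded z_def] by linarith
qed

text \<open>The one-step errors merely add up, because the multiplier
  \<open>1 - s\<^sup>2 * v / 2\<close> has absolute value at most 1 when
  \<open>s\<^sup>2 * v \<le> 2\<close>.\<close>

lemma char_power_bound:
  assumes M: "\<And>x. \<bar>\<psi> x\<bar> \<le> M" and e: "\<And>x. \<bar>(L ^^ m) (L (\<lambda>x. (\<psi> x)\<^sup>2 - v)) x\<bar> \<le> e"
    and s: "s\<^sup>2 * v \<le> 2"
  shows "norm ((\<integral>x. W s k x \<partial>\<mu>) - of_real (1 - s\<^sup>2 * v / 2) ^ k)
    \<le> real k * (\<bar>s\<bar> ^ 3 * M ^ 3 / 6 + s\<^sup>2 / 2 * (2 * M\<^sup>2 * (\<bar>s\<bar> * (real m * M)) + e))"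
    (is "_ \<le> real k * ?E")
proof (induction k)
  case 0
  then show ?case by (simp add: W_0 prob_space)
next
  case (Suc k)
  define z where "z = complex_of_real (1 - s\<^sup>2 * v / 2)"
  have "v \<ge> 0" by (simp add: v_def)
  then have z: "norm z \<le> 1" unfolding z_def norm_of_real using s by (simp add: abs_le_iff)
  have "(\<integral>x. W s (Suc k) x \<partial>\<mu>) - z ^ Suc k
      = ((\<integral>x. W s (Suc k) x \<partial>\<mu>) - z * (\<integral>x. W s k x \<partial>\<mu>)) + z * ((\<integral>x. W s k x \<partial>\<mu>) - z ^ k)"
    by (simp add: algebra_simps)
  also have "norm \<dots> \<le> ?E + real k * ?E"
  proof (rule norm_triangle_mono)
    show "norm ((\<integral>x. W s (Suc k) x \<partial>\<mu>) - z * (\<integral>x. W s k x \<partial>\<mu>)) \<le> ?E"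
      unfolding z_def by (rule char_step[OF M e])
    have "norm (z * ((\<integral>x. W s k x \<partial>\<mu>) - z ^ k)) \<le> 1 * norm ((\<integral>x. W s k x \<partial>\<mu>) - z ^ k)"
      unfolding norm_mult by (rule mult_right_mono[OF z]) simp
    also have "\<dots> \<le> real k * ?E" using Suc by (simp add: z_def)
    finally show "norm (z * ((\<integral>x. W s k x \<partial>\<mu>) - z ^ k)) \<le> real k * ?E" .
  qed
  also have "?E + real k * ?E = real (Suc k) * ?E" by (simp only: of_nat_Suc ring_distribs mult_1 add.commute)
  finally show ?case unfolding z_def .
qed

text \<open>At \<open>s = t / sqrt n\<close> the error accumulated over \<open>n\<close> steps is of
  order \<open>m / sqrt n\<close> plus \<open>t\<^sup>2 * e / 2\<close>. First \<open>m\<close> is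
  fixed to make \<open>e\<close> small, then \<open>n\<close> tends to infinity.\<close>

lemma char_limit:
  "(\<lambda>n. \<integral>x. W (t / sqrt (real n)) n x \<partial>\<mu>) \<longlonglongrightarrow> of_real (exp (- (t\<^sup>2 * v) / 2))"
proof -
  obtain M where M: "\<And>x. \<bar>\<psi> x\<bar> \<le> M" using continuous_bounded[OF continuous_psi] by auto
  define c where "c x = (\<psi> x)\<^sup>2 - v" for x
  have csq: "continuous_on UNIV (\<lambda>x. (\<psi> x)\<^sup>2)" by (intro continuous_intros continuous_psi)
  have cc: "continuous_on UNIV c" unfolding c_def by (intro continuous_intros continuous_psi)
  have c0: "(\<integral>x. L c x \<partial>\<mu>) = 0"
    unfolding integral_L[OF cc] unfolding c_def by (subst Bochner_Integration.integral_diff)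
      (auto intro!: integrable_continuous csq simp: v_def prob_space)
  have ul: "uniform_limit UNIV (\<lambda>n. (L ^^ n) (L c)) (\<lambda>_. 0) sequentially"
    using L_mixing[OF continuous_L[OF cc]] by (simp add: c0)
  define z where "z n = complex_of_real (1 - (t / sqrt (real n))\<^sup>2 * v / 2) ^ n" for n
  have z: "z \<longlonglongrightarrow> of_real (exp (- (t\<^sup>2 * v) / 2))"
  proof -
    have "(\<lambda>n. of_real ((1 + (- (t\<^sup>2 * v) / 2) / real n) ^ n)) \<longlonglongrightarrow> complex_of_real (exp (- (t\<^sup>2 * v) / 2))"
      by (intro tendsto_of_real tendsto_exp_limit_sequentially)
    moreover have "z = (\<lambda>n. of_real ((1 + (- (t\<^sup>2 * v) / 2) / real n) ^ n))"
      by (rule ext) (simp add: z_def power_divide mult.commute)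
    ultimately show ?thesis by (simp only:)
  qed
  have "(\<lambda>n. (\<integral>x. W (t / sqrt (real n)) n x \<partial>\<mu>) - z n) \<longlonglongrightarrow> 0"
  proof (rule tendstoI)
    fix \<epsilon> :: real assume \<epsilon>: "\<epsilon> > 0"
    \<comment> \<open>The summand 1 keeps the denominator positive when
      \<open>t = 0\<close>.\<close>
    define e where "e = \<epsilon> / (t\<^sup>2 + 1)"
    have tp: "t\<^sup>2 + 1 > 0" by (simp add: add_nonneg_pos)
    have e: "e > 0" using \<epsilon> tp by (simp add: e_def)
    have te: "t\<^sup>2 / 2 * e < \<epsilon>"
    proof -
      have "t\<^sup>2 / 2 * e < (t\<^sup>2 + 1) * e" using e by (intro mult_strict_right_mono) (auto simp: add_nonneg_pos)
      also have "\<dots> = \<epsilon>" using tp by (simp add: e_def)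
      finally show ?thesis .
    qed
    obtain m where m: "\<And>x. \<bar>(L ^^ m) (L c) x\<bar> \<le> e"
      using uniform_limitD[OF ul e] by (auto simp: eventually_sequentially dest!: less_imp_le)
    \<comment> \<open>This is \<open>n\<close> times the error of \<open>char_step\<close> at
      \<open>s = t / sqrt n\<close>; two of the three powers of \<open>s\<close> cancel
      \<open>n\<close>, except in the term with \<open>e\<close>, where both are used up.\<close>
    define b where "b n = (\<bar>t\<bar> ^ 3 * M ^ 3 / 6 + t\<^sup>2 * M\<^sup>2 * (\<bar>t\<bar> * (real m * M))) / sqrt (real n) + t\<^sup>2 / 2 * e" for n
    have "b \<longlonglongrightarrow> 0 + t\<^sup>2 / 2 * e"
      unfolding b_def
      by (intro tendsto_intros tendsto_divide_0[OF tendsto_const]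
           filterlim_at_top_imp_at_infinity filterlim_compose[OF sqrt_at_top filterlim_real_sequentially])
    then have "eventually (\<lambda>n. b n < \<epsilon>) sequentially"
      using te by (simp add: order_tendstoD(2))
    moreover have "eventually (\<lambda>n. t\<^sup>2 * v \<le> 2 * real n \<and> n > 0) sequentially"
    proof -
      have "eventually (\<lambda>n. real n \<ge> t\<^sup>2 * v) sequentially"
        using filterlim_real_sequentially by (simp add: filterlim_at_top)
      then show ?thesis using eventually_gt_at_top[of 0] by eventually_elim auto
    qed
    ultimately show "eventually (\<lambda>n. dist ((\<integral>x. W (t / sqrt (real n)) n x \<partial>\<mu>) - z n) 0 < \<epsilon>) sequentially"
    proof eventually_elim
      case (elim n)
      define r where "r = sqrt (real n)"
      have r: "r > 0" "r\<^sup>2 = real n" using elim by (auto simp: r_def)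
      have s2: "(t / r)\<^sup>2 * v \<le> 2" using elim r by (simp add: power_divide field_simps)
      have abs_r: "\<bar>t / r\<bar> = \<bar>t\<bar> / r" using r by simp
      have "norm ((\<integral>x. W (t / r) n x \<partial>\<mu>) - z n)
         \<le> real n * (\<bar>t / r\<bar> ^ 3 * M ^ 3 / 6 + (t / r)\<^sup>2 / 2 * (2 * M\<^sup>2 * (\<bar>t / r\<bar> * (real m * M)) + e))"
        using char_power_bound[OF M m[unfolded c_def] s2, of n] by (simp add: z_def r_def)
      also have "\<dots> = b n"
        unfolding b_def abs_r r_def[symmetric] r(2)[symmetric]
        using r(1) by (simp add: field_simps power2_eq_square power3_eq_cube)
      finally show ?case using elim by (simp add: r_def)
    qed
  qed
  from tendsto_add[OF this z] show ?thesis by simp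
qed

text \<open>The coboundary changes each Birkhoff sum by a bounded amount, which disappears after
  division by \<open>sqrt n\<close>. The characteristic functions therefore have the Gaussian limit
  from \<open>char_limit\<close>, and Levy continuity gives weak convergence.\<close>

theorem central_limit:
  assumes u: "continuous_on UNIV u" and \<phi>: "\<And>x. \<phi> x = \<psi> x - u x + u (T x)" and v: "v > 0"
  shows "(\<lambda>n. measure \<mu> {x. 1 / sqrt (real n) * birkhoff_sum T \<phi> n x < b})
    \<longlonglongrightarrow> 1 / (sqrt v * sqrt (2 * pi)) * (LINT t:{..b}|lborel. exp (- (t\<^sup>2) / (2 * (sqrt v)\<^sup>2)))"
proof -
  define \<gamma> where "\<gamma> = sqrt v"
  have \<gamma>: "\<gamma> > 0" "\<gamma>\<^sup>2 = v" using v by (auto simp: \<gamma>_def)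
  have c\<phi>: "continuous_on UNIV \<phi>"
    unfolding \<phi> by (intro continuous_intros u continuous_psi continuous_on_compose2[OF u continuous_T]) auto
  define X where "X n x = birkhoff_sum T \<phi> n x / (\<gamma> * sqrt (real n))" for n x
  have cX: "continuous_on UNIV (X n)" for n
    unfolding X_def divide_inverse by (intro continuous_intros continuous_birkhoff_sum c\<phi>)
  note X_meas[measurable] = measurable_continuous[OF cX]
  define D where "D n = distr \<mu> borel (X n)" for n
  interpret std: prob_space std_normal_distribution by (rule prob_space_normal_density) simp
  have rd: "real_distribution (D n)" for n
    unfolding D_def by (rule real_distribution_distr[OF X_meas])
  have rs: "real_distribution std_normal_distribution"
    by (rule real_dist_normal_dist)
  obtain B where B: "\<And>x. \<bar>u x\<bar> \<le> B" using continuous_bounded[OF u] by auto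
  have char_D: "(\<lambda>n. char (D n) t) \<longlonglongrightarrow> char std_normal_distribution t" for t
  proof -
    define s where "s n = t / \<gamma> / sqrt (real n)" for n
    have D_eq: "char (D n) t = (\<integral>x. iexp (s n * birkhoff_sum T \<phi> n x) \<partial>\<mu>)" for n
      unfolding char_def D_def
      by (subst integral_distr) (auto simp: X_def s_def field_simps)
    \<comment> \<open>The exponents differ by \<open>s n\<close> times a difference of two values of
      \<open>u\<close>, at most \<open>2 * B\<close>.\<close>
    have "(\<lambda>n. char (D n) t - (\<integral>x. W (s n) n x \<partial>\<mu>)) \<longlonglongrightarrow> 0"
    proof (rule Lim_null_comparison)
      have "(\<lambda>n. \<bar>t / \<gamma>\<bar> * (2 * B) / sqrt (real n)) \<longlonglongrightarrow> 0"
        by (intro tendsto_divide_0[OF tendsto_const] filterlim_at_top_imp_at_infinity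
              filterlim_compose[OF sqrt_at_top filterlim_real_sequentially])
      then show "(\<lambda>n. \<bar>s n\<bar> * (2 * B)) \<longlonglongrightarrow> 0" by (simp add: s_def abs_mult)
      have "norm (char (D n) t - (\<integral>x. W (s n) n x \<partial>\<mu>)) \<le> \<bar>s n\<bar> * (2 * B)" for n
      proof -
        define Y where "Y x = iexp (s n * birkhoff_sum T \<phi> n x)" for x
        have cY: "continuous_on UNIV Y"
          unfolding Y_def by (intro continuous_intros continuous_birkhoff_sum c\<phi>)
        have "Y x = W (s n) n x * iexp (s n * (u ((T ^^ n) x) - u x))" for x
          unfolding Y_def W_def birkhoff_sum_coboundary[where \<phi>=\<phi> and \<psi>=\<psi> and u=u and T=T, OF \<phi>]
          by (simp flip: exp_add) (simp add: algebra_simps)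
        then have "norm (Y x - W (s n) n x) = norm (W (s n) n x * (iexp (s n * (u ((T ^^ n) x) - u x)) - 1))" for x
          by (simp add: algebra_simps)
        moreover have "norm (iexp (s n * (u ((T ^^ n) x) - u x)) - 1) \<le> \<bar>s n\<bar> * (2 * B)" for x
        proof (rule order_trans[OF norm_iexp_minus_1])
          have "\<bar>u ((T ^^ n) x) - u x\<bar> \<le> 2 * B" using B[of x] B[of "(T ^^ n) x"] by linarith
          then show "\<bar>s n * (u ((T ^^ n) x) - u x)\<bar> \<le> \<bar>s n\<bar> * (2 * B)"
            by (simp add: abs_mult mult_left_mono)
        qed
        ultimately have "norm (\<integral>x. Y x - W (s n) n x \<partial>\<mu>) \<le> \<bar>s n\<bar> * (2 * B)"
          by (intro norm_integral_le continuous_intros cY continuous_W) (simp add: norm_mult norm_W)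
        then show ?thesis
          unfolding D_eq Y_def[symmetric]
          by (simp add: Bochner_Integration.integral_diff integrable_continuous cY continuous_W)
      qed
      then show "eventually (\<lambda>n. norm (char (D n) t - (\<integral>x. W (s n) n x \<partial>\<mu>)) \<le> \<bar>s n\<bar> * (2 * B)) sequentially"
        by simp
    qed
    from tendsto_add[OF this char_limit[of "t / \<gamma>", folded s_def]]
    have "(\<lambda>n. char (D n) t) \<longlonglongrightarrow> of_real (exp (- ((t / \<gamma>)\<^sup>2 * v) / 2))" by simp
    moreover have "(t / \<gamma>)\<^sup>2 * v = t\<^sup>2" using \<gamma> v by (simp add: power_divide)
    ultimately show ?thesis by (simp add: char_std_normal_distribution)
  qed
  have weak: "weak_conv_m D std_normal_distribution"
    by (rule levy_continuity[OF rd rs char_D])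
  \<comment> \<open>The normal law has no atoms, so the open half-line is a continuity set.\<close>
  have "emeasure std_normal_distribution (frontier {..<b / \<gamma>}) = 0"
    by (simp add: emeasure_density)
  from weak_conv_imp_continuity_set_conv[OF rd rs weak _ this]
  have lim: "(\<lambda>n. measure (D n) {..<b / \<gamma>}) \<longlonglongrightarrow> measure std_normal_distribution {..<b / \<gamma>}" by simp
  have D_meas: "measure (D n) {..<b / \<gamma>} = measure \<mu> {x. 1 / sqrt (real n) * birkhoff_sum T \<phi> n x < b}" for n
  proof -
    have "X n -` {..<b / \<gamma>} = {x. 1 / sqrt (real n) * birkhoff_sum T \<phi> n x < b}"
      using \<gamma>(1) by (auto simp: X_def field_simps)
    then show ?thesis unfolding D_def by (subst measure_distr) (auto simp: space_mu)
  qed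
  have "measure std_normal_distribution {..<b / \<gamma>} = (\<integral>x. indicator {..<b / \<gamma>} x \<partial>std_normal_distribution)"
    by simp
  also have "\<dots> = (\<integral>x. std_normal_density x * indicator {..<b / \<gamma>} x \<partial>lborel)"
    by (subst integral_density) auto
  \<comment> \<open>Prepares the substitution \<open>t = \<gamma> * x\<close>. The strict and the
    weak inequality differ only at the point \<open>b / \<gamma>\<close>, so equality holds almost
    everywhere.\<close>
  also have "\<dots> = (\<integral>x. 1 / (\<gamma> * sqrt (2 * pi)) * \<gamma> * (indicator {..b} (\<gamma> * x) * exp (- ((\<gamma> * x)\<^sup>2) / (2 * \<gamma>\<^sup>2))) \<partial>lborel)"
  proof (rule integral_cong_AE)
    show "AE x in lborel. std_normal_density x * indicator {..<b / \<gamma>} x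
        = 1 / (\<gamma> * sqrt (2 * pi)) * \<gamma> * (indicator {..b} (\<gamma> * x) * exp (- ((\<gamma> * x)\<^sup>2) / (2 * \<gamma>\<^sup>2)))"
      using AE_lborel_singleton[of "b / \<gamma>"]
    proof eventually_elim
      case (elim x)
      have "x < b / \<gamma> \<longleftrightarrow> \<gamma> * x \<le> b" using elim \<gamma>(1) by (auto simp: field_simps)
      then show ?case using \<gamma>(1) by (auto simp: std_normal_density_def indicator_def power_mult_distrib)
    qed
  qed measurable
  also have "\<dots> = 1 / (\<gamma> * sqrt (2 * pi)) * (\<gamma> * (\<integral>x. indicator {..b} (\<gamma> * x) * exp (- ((\<gamma> * x)\<^sup>2) / (2 * \<gamma>\<^sup>2)) \<partial>lborel))"
    by (simp only: integral_mult_right_zero mult.assoc)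
  also have "\<gamma> * (\<integral>x. indicator {..b} (\<gamma> * x) * exp (- ((\<gamma> * x)\<^sup>2) / (2 * \<gamma>\<^sup>2)) \<partial>lborel)
      = (LINT t:{..b}|lborel. exp (- (t\<^sup>2) / (2 * \<gamma>\<^sup>2)))"
    using lborel_integral_real_affine[of \<gamma> "\<lambda>t. indicator {..b} t * exp (- (t\<^sup>2) / (2 * \<gamma>\<^sup>2))" 0] \<gamma>(1)
    by (simp add: set_lebesgue_integral_def)
  finally show ?thesis using lim unfolding D_meas by (simp only: \<gamma>_def)
qed

end

section \<open>Spectral gap and martingale decomposition\<close>

text \<open>Take tents of radius \<open>r\<close> centred at finitely many points whose balls cover
  the space, and divide by their sum, which is positive by the covering.\<close>

lemma finite_partition_of_unity:
  fixes r :: real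
  assumes "compact (UNIV :: 'a::metric_space set)" "r > 0"
  obtains P :: "'a::metric_space set" and \<zeta> :: "'a \<Rightarrow> 'a \<Rightarrow> real" where "finite P" "\<And>p. continuous_on UNIV (\<zeta> p)" "\<And>p x. \<zeta> p x \<ge> 0"
    "\<And>p x. \<zeta> p x \<noteq> 0 \<Longrightarrow> dist x p < r" "\<And>x. (\<Sum>p\<in>P. \<zeta> p x) = 1"
proof -
  obtain P :: "'a set" where P: "finite P" "UNIV \<subseteq> (\<Union>p\<in>P. ball p r)"
    using compactE_image[OF assms(1), of UNIV "\<lambda>p. ball p r"] assms(2)
    by (metis UNIV_I UN_I centre_in_ball open_ball subsetI)
  define w :: "'a \<Rightarrow> 'a \<Rightarrow> real" where "w p x = max 0 (r - dist x p)" for p x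
  define s where "s x = (\<Sum>p\<in>P. w p x)" for x
  have w0: "w p x \<ge> 0" for p x by (simp add: w_def)
  have s0: "s x > 0" for x
  proof -
    obtain p where p: "p \<in> P" "dist p x < r" using P(2) by (metis UNIV_I UN_E mem_ball subsetD)
    then have "0 < w p x" by (simp add: w_def dist_commute)
    also have "w p x \<le> s x" unfolding s_def using p w0 P(1) by (intro member_le_sum) auto
    finally show ?thesis .
  qed
  have cw: "continuous_on UNIV (w p)" for p unfolding w_def by (intro continuous_intros)
  show ?thesis
  proof (rule that[OF P(1), of "\<lambda>p x. w p x / s x"])
    show "continuous_on UNIV (\<lambda>x. w p x / s x)" for p
    proof (intro continuous_on_divide cw)
      show "continuous_on UNIV s" unfolding s_def by (intro continuous_on_sum cw)
    qed (metis s0 less_irrefl)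
    show "0 \<le> w p x / s x" for p x using w0 s0[of x] by simp
    show "dist x p < r" if "w p x / s x \<noteq> 0" for p x
      using that by (auto simp: w_def max_def split: if_splits)
    show "(\<Sum>p\<in>P. w p x / s x) = 1" for x
      using s0[of x] by (simp flip: sum_divide_distrib s_def)
  qed
qed

text \<open>Two-norm setting with the local \<open>\<Omega>\<close>-constant \<open>A\<close> as
  strong norm and the sup bound \<open>M\<close> as weak norm; only pairs at distance below
  \<open>\<rho>\<close> are compared.\<close>

locale lasota_yorke = normalized_transfer \<mu> T L
  for \<mu> :: "'a::metric_space measure" and T L +
  fixes \<Omega> :: "real \<Rightarrow> real" and \<rho> \<theta> K :: real
  assumes rho_pos: "\<rho> > 0" and theta: "0 \<le> \<theta>" "\<theta> < 1" and K_nonneg: "K \<ge> 0"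
    and Omega_nonneg: "0 \<le> t \<Longrightarrow> 0 \<le> \<Omega> t"
    and Omega_small: "\<epsilon> > 0 \<Longrightarrow> \<exists>r>0. \<forall>t. 0 \<le> t \<longrightarrow> t < r \<longrightarrow> \<Omega> t \<le> \<epsilon>"
    and lasota_yorke_step: "\<lbrakk>continuous_on UNIV a; \<And>x. \<bar>a x\<bar> \<le> M; 0 \<le> A;
        \<And>x y. dist x y < \<rho> \<Longrightarrow> \<bar>a x - a y\<bar> \<le> A * \<Omega> (dist x y); dist x y < \<rho>\<rbrakk>
        \<Longrightarrow> \<bar>L a x - L a y\<bar> \<le> (\<theta> * A + K * M) * \<Omega> (dist x y)"
begin

section \<open>Iterated Lasota-Yorke inequality and uniform mixing\<close>

definition regular :: "real \<Rightarrow> real \<Rightarrow> ('a \<Rightarrow> real) \<Rightarrow> bool" where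
  "regular A M a \<longleftrightarrow> continuous_on UNIV a \<and> 0 \<le> A \<and> (\<forall>x. \<bar>a x\<bar> \<le> M) \<and>
     (\<forall>x y. dist x y < \<rho> \<longrightarrow> \<bar>a x - a y\<bar> \<le> A * \<Omega> (dist x y))"

lemma regular_nonneg: "regular A M a \<Longrightarrow> 0 \<le> A \<and> 0 \<le> M"
  unfolding regular_def by (metis abs_ge_zero order_trans)

lemma regular_continuous: "regular A M a \<Longrightarrow> continuous_on UNIV a"
  by (simp add: regular_def)

lemma regular_L: "regular A M a \<Longrightarrow> regular (\<theta> * A + K * M) M (L a)"
  using regular_nonneg[of A M a] lasota_yorke_step[of a M A] K_nonneg theta
  by (auto simp: regular_def continuous_L L_abs_le)

text \<open>The fixed point of the affine recursion \<open>x \<mapsto> \<theta> * x + K\<close>,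
  which governs the constants under iteration.\<close>

definition D :: real where "D = K / (1 - \<theta>)"

lemma D: "D \<ge> 0" "\<theta> * D + K = D"
  using theta K_nonneg by (auto simp: D_def field_simps)

lemma regular_mono: "regular A M a \<Longrightarrow> A \<le> B \<Longrightarrow> M \<le> N \<Longrightarrow> regular B N a"
  unfolding regular_def
  by (meson Omega_nonneg mult_right_mono order_trans zero_le_dist)

lemma regular_Ln: assumes "regular A M a" shows "regular (\<theta> ^ n * A + D * M) M ((L ^^ n) a)"
proof (induction n)
  case 0
  show ?case using assms regular_nonneg[OF assms] D(1) by (auto intro: regular_mono)
next
  case (Suc n)
  have "\<theta> * (\<theta> ^ n * A + D * M) + K * M = \<theta> ^ Suc n * A + (\<theta> * D + K) * M"
    by (simp add: algebra_simps)
  then show ?case using regular_L[OF Suc] by (simp add: D(2))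
qed

text \<open>Uniformity over the class comes from approximating \<open>a\<close> by a combination of the finitely many
  functions of a partition of unity.\<close>

lemma uniform_mixing:
  assumes "\<epsilon> > 0"
  obtains n0 where "\<And>n a A M x. \<lbrakk>n \<ge> n0; regular A M a\<rbrakk> \<Longrightarrow> \<bar>(L ^^ n) a x - (\<integral>x. a x \<partial>\<mu>)\<bar> \<le> \<epsilon> * (A + M)"
proof -
  obtain r0 where r0: "r0 > 0" "\<And>t. \<lbrakk>0 \<le> t; t < r0\<rbrakk> \<Longrightarrow> \<Omega> t \<le> \<epsilon> / 2"
    using Omega_small[of "\<epsilon> / 2"] assms by auto
  define r where "r = min r0 \<rho>"
  have r: "r > 0" using r0 rho_pos by (simp add: r_def)
  obtain P :: "'a set" and \<zeta> :: "'a \<Rightarrow> 'a \<Rightarrow> real" where P: "finite P" and c\<zeta>: "\<And>p. continuous_on UNIV (\<zeta> p)"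
    and \<zeta>0: "\<And>p x. \<zeta> p x \<ge> 0" and supp: "\<And>p x. \<zeta> p x \<noteq> 0 \<Longrightarrow> dist x p < r"
    and unity: "\<And>x. (\<Sum>p\<in>P. \<zeta> p x) = 1"
    using finite_partition_of_unity[OF compact_space r] by blast
  define I where "I p = (\<integral>x. \<zeta> p x \<partial>\<mu>)" for p
  \<comment> \<open>Sized so that the errors over all of \<open>P\<close> add up to at most
    \<open>\<epsilon>\<close>; the 1 avoids a zero denominator.\<close>
  define \<delta> where "\<delta> = \<epsilon> / (real (card P) + 1)"
  have \<delta>: "\<delta> > 0" "real (card P) * \<delta> \<le> \<epsilon>" using assms by (auto simp: \<delta>_def field_simps)
  have "\<forall>\<^sub>F n in sequentially. \<forall>p\<in>P. \<forall>x. \<bar>(L ^^ n) (\<zeta> p) x - I p\<bar> < \<delta>"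
    using P uniform_limitD[OF L_mixing[OF c\<zeta>] \<delta>(1)]
    by (simp add: eventually_ball_finite_distrib I_def dist_real_def)
  then obtain n0 where n0: "\<And>n p x. \<lbrakk>n \<ge> n0; p \<in> P\<rbrakk> \<Longrightarrow> \<bar>(L ^^ n) (\<zeta> p) x - I p\<bar> < \<delta>"
    by (auto simp: eventually_sequentially)
  show ?thesis
  proof (rule that[of n0])
    fix n a A M x assume n: "n \<ge> n0" and reg: "regular A M a"
    have A: "A \<ge> 0" and M: "M \<ge> 0" and ca: "continuous_on UNIV a" and aM: "\<And>x. \<bar>a x\<bar> \<le> M"
      using reg regular_nonneg[OF reg] by (auto simp: regular_def)
    define s where "s x = (\<Sum>p\<in>P. a p * \<zeta> p x)" for x
    define d where "d x = a x - s x" for x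
    have cs: "continuous_on UNIV s" unfolding s_def by (intro continuous_intros c\<zeta>)
    have cd: "continuous_on UNIV d" unfolding d_def by (intro continuous_intros ca cs)
    have d: "\<bar>d x\<bar> \<le> A * (\<epsilon> / 2)" for x
    proof -
      have "d x = (\<Sum>p\<in>P. (a x - a p) * \<zeta> p x)"
        using arg_cong[OF unity[of x], of "\<lambda>z. a x * z"]
        by (simp add: d_def s_def left_diff_distrib sum_subtractf sum_distrib_left)
      also have "\<bar>\<dots>\<bar> \<le> (\<Sum>p\<in>P. \<bar>a x - a p\<bar> * \<zeta> p x)"
        by (rule order_trans[OF sum_abs]) (simp add: abs_mult \<zeta>0)
      also have "\<dots> \<le> (\<Sum>p\<in>P. A * (\<epsilon> / 2) * \<zeta> p x)"
      proof (rule sum_mono)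
        fix p
        show "\<bar>a x - a p\<bar> * \<zeta> p x \<le> A * (\<epsilon> / 2) * \<zeta> p x"
        proof (cases "\<zeta> p x = 0")
          case False
          then have xp: "dist x p < r0" "dist x p < \<rho>" using supp[of p x] by (auto simp: r_def)
          then have "\<bar>a x - a p\<bar> \<le> A * \<Omega> (dist x p)" using reg by (simp add: regular_def)
          also have "\<dots> \<le> A * (\<epsilon> / 2)" using r0(2)[of "dist x p"] xp A by (intro mult_left_mono) auto
          finally show ?thesis using \<zeta>0 by (rule mult_right_mono)
        qed simp
      qed
      also have "\<dots> = A * (\<epsilon> / 2)" unfolding sum_distrib_left[symmetric] unity by simp
      finally show ?thesis .
    qed
    have "a = (\<lambda>x. s x + d x)" by (simp add: d_def)
    then have La: "(L ^^ n) a x = (L ^^ n) s x + (L ^^ n) d x" using Ln_add[of n s d] by metis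
    have Ls: "(L ^^ n) s x = (\<Sum>p\<in>P. a p * (L ^^ n) (\<zeta> p) x)"
      unfolding s_def by (simp add: Ln_sum[OF P] Ln_scale)
    have "(\<integral>x. s x \<partial>\<mu>) = (\<Sum>p\<in>P. a p * I p)"
      unfolding s_def I_def
      by (subst Bochner_Integration.integral_sum) (auto intro!: integrable_continuous continuous_intros c\<zeta>)
    moreover have "(\<integral>x. a x \<partial>\<mu>) = (\<integral>x. s x \<partial>\<mu>) + (\<integral>x. d x \<partial>\<mu>)"
      unfolding d_def using Bochner_Integration.integral_diff[OF integrable_continuous[OF ca] integrable_continuous[OF cs]]
      by simp
    \<comment> \<open>The finite combination contributes at most \<open>\<epsilon> * M\<close>; the
      remainder \<open>d\<close> enters twice, each time with at most
      \<open>A * \<epsilon> / 2\<close>.\<close>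
    ultimately have eq: "(L ^^ n) a x - (\<integral>x. a x \<partial>\<mu>)
        = (\<Sum>p\<in>P. a p * ((L ^^ n) (\<zeta> p) x - I p)) + (L ^^ n) d x - (\<integral>x. d x \<partial>\<mu>)"
      unfolding La Ls by (simp add: right_diff_distrib sum_subtractf)
    have "\<bar>\<Sum>p\<in>P. a p * ((L ^^ n) (\<zeta> p) x - I p)\<bar> \<le> (\<Sum>p\<in>P. M * \<delta>)"
    proof (rule order_trans[OF sum_abs sum_mono])
      fix p assume "p \<in> P"
      then show "\<bar>a p * ((L ^^ n) (\<zeta> p) x - I p)\<bar> \<le> M * \<delta>"
        unfolding abs_mult using n0[OF n, of p x] aM M by (intro mult_mono) auto
    qed
    also have "\<dots> = real (card P) * \<delta> * M" by simp
    also have "\<dots> \<le> \<epsilon> * M" using \<delta>(2) M by (rule mult_right_mono)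
    finally have 1: "\<bar>\<Sum>p\<in>P. a p * ((L ^^ n) (\<zeta> p) x - I p)\<bar> \<le> \<epsilon> * M" .
    have 2: "\<bar>(L ^^ n) d x\<bar> \<le> A * (\<epsilon> / 2)" by (rule Ln_abs_le[OF d])
    have 3: "\<bar>\<integral>x. d x \<partial>\<mu>\<bar> \<le> A * (\<epsilon> / 2)" using norm_integral_le[OF cd, of "A * (\<epsilon> / 2)"] d by simp
    show "\<bar>(L ^^ n) a x - (\<integral>x. a x \<partial>\<mu>)\<bar> \<le> \<epsilon> * (A + M)"
      unfolding eq using 1 2 3 by (simp add: algebra_simps)
  qed
qed

section \<open>Contraction of the combined norm \<open>A + w * M\<close> and exponential
  decay\<close>

definition w :: real where "w = 2 * D + 2"

text \<open>For large \<open>n\<close> the strong part is halved up to \<open>D * M\<close>, and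
  this term is at most half of \<open>w * M\<close> by the choice of \<open>w\<close>. With mean
  zero, \<open>uniform_mixing\<close> at \<open>1 / (4 * w)\<close> limits the new weighted sup
  bound to \<open>(A + M) / 4\<close>. The total is at most three quarters of the old norm.\<close>

lemma contraction_power:
  obtains n where "n > 0" "\<And>a A M. \<lbrakk>regular A M a; (\<integral>x. a x \<partial>\<mu>) = 0\<rbrakk>
    \<Longrightarrow> \<exists>A' M'. regular A' M' ((L ^^ n) a) \<and> A' + w * M' \<le> 3/4 * (A + w * M)"
proof -
  have w: "w > 0" using D(1) by (simp add: w_def)
  obtain n0 where n0: "\<And>n a A M x. \<lbrakk>n \<ge> n0; regular A M a\<rbrakk>
      \<Longrightarrow> \<bar>(L ^^ n) a x - (\<integral>x. a x \<partial>\<mu>)\<bar> \<le> 1 / (4 * w) * (A + M)"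
    using uniform_mixing[of "1 / (4 * w)"] w by auto
  have "(\<lambda>n. \<theta> ^ n) \<longlonglongrightarrow> 0" using theta by (intro LIMSEQ_realpow_zero) auto
  then have "eventually (\<lambda>n. \<theta> ^ n < 1/2) sequentially" by (rule order_tendstoD(2)) simp
  then have "eventually (\<lambda>n. \<theta> ^ n < 1/2 \<and> n \<ge> n0 \<and> n > 0) sequentially"
    using eventually_ge_at_top[of n0] eventually_gt_at_top[of 0] by eventually_elim auto
  then obtain n where n: "\<theta> ^ n < 1/2" "n \<ge> n0" "n > 0" by (auto simp: eventually_sequentially)
  show ?thesis
  proof (rule that[OF n(3)])
    fix a A M assume reg: "regular A M a" and a0: "(\<integral>x. a x \<partial>\<mu>) = 0"
    have AM: "A \<ge> 0" "M \<ge> 0" using regular_nonneg[OF reg] by auto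
    define A' where "A' = \<theta> ^ n * A + D * M"
    define M' where "M' = 1 / (4 * w) * (A + M)"
    have "regular A' M' ((L ^^ n) a)"
      using regular_Ln[OF reg, of n] n0[OF n(2) reg] a0 by (auto simp: regular_def A'_def M'_def)
    moreover have "A' + w * M' \<le> 3/4 * (A + w * M)"
    proof -
      have "w * M' = A / 4 + M / 4" using w by (simp add: M'_def field_simps)
      moreover have "\<theta> ^ n * A \<le> 1/2 * A" using n AM by (intro mult_right_mono) auto
      moreover have "w * M = 2 * (D * M) + 2 * M" by (simp add: w_def algebra_simps)
      moreover have "D * M \<ge> 0" using D(1) AM by simp
      ultimately have "A' + w * M' \<le> 1/2 * A + D * M + (A / 4 + M / 4)" "3/4 * (A + w * M) = 3/4 * A + 3/2 * (D * M) + 3/2 * M" "D * M \<ge> 0"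
        unfolding A'_def by (auto simp: algebra_simps)
      then show ?thesis using AM by linarith
    qed
    ultimately show "\<exists>A' M'. regular A' M' ((L ^^ n) a) \<and> A' + w * M' \<le> 3/4 * (A + w * M)" by blast
  qed
qed

lemma exponential_decay:
  assumes reg: "regular A M a" and a0: "(\<integral>x. a x \<partial>\<mu>) = 0"
  shows "\<exists>C q. 0 < q \<and> q < 1 \<and> (\<forall>n x. \<bar>(L ^^ n) a x\<bar> \<le> C * q ^ n)"
proof -
  have w: "w > 0" using D(1) by (simp add: w_def)
  obtain N where N: "N > 0" "\<And>a A M. \<lbrakk>regular A M a; (\<integral>x. a x \<partial>\<mu>) = 0\<rbrakk>
    \<Longrightarrow> \<exists>A' M'. regular A' M' ((L ^^ N) a) \<and> A' + w * M' \<le> 3/4 * (A + w * M)"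
    using contraction_power by blast
  define B where "B = A + w * M"
  have B: "B \<ge> 0" using regular_nonneg[OF reg] w by (simp add: B_def)
  have it: "\<exists>A' M'. regular A' M' ((L ^^ (N * k)) a) \<and> A' + w * M' \<le> (3/4) ^ k * B" for k
  proof (induction k)
    case 0
    show ?case using reg by (auto simp: B_def)
  next
    case (Suc k)
    then obtain A1 M1 where 1: "regular A1 M1 ((L ^^ (N * k)) a)" "A1 + w * M1 \<le> (3/4) ^ k * B" by blast
    have "(\<integral>x. (L ^^ (N * k)) a x \<partial>\<mu>) = 0" using integral_Ln[OF regular_continuous[OF reg]] a0 by simp
    from N(2)[OF 1(1) this] obtain A2 M2 where
      2: "regular A2 M2 ((L ^^ N) ((L ^^ (N * k)) a))" "A2 + w * M2 \<le> 3/4 * (A1 + w * M1)" by blast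
    have "(L ^^ N) ((L ^^ (N * k)) a) = (L ^^ (N * Suc k)) a" by (simp add: funpow_add)
    with 1 2 show ?case by (intro exI[of _ A2] exI[of _ M2]) auto
  qed
  \<comment> \<open>The rate is chosen so that \<open>N\<close> steps cost exactly the factor
    3/4.\<close>
  define q where "q = root N (3/4)"
  have q: "0 < q" "q < 1" "q ^ N = 3/4" using N(1) by (auto simp: q_def)
  have "\<bar>(L ^^ n) a x\<bar> \<le> 4 / 3 * B / w * q ^ n" for n x
  proof -
    define k where "k = n div N"
    obtain A' M' where 1: "regular A' M' ((L ^^ (N * k)) a)" "A' + w * M' \<le> (3/4) ^ k * B" using it by blast
    have "(L ^^ n) a = (L ^^ (n mod N)) ((L ^^ (N * k)) a)"
      by (metis add.commute comp_apply funpow_add k_def mult_div_mod_eq)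
    then have "\<bar>(L ^^ n) a x\<bar> \<le> M'"
      using 1(1) Ln_abs_le[of "(L ^^ (N * k)) a" M' "n mod N" x] by (simp add: regular_def)
    also have "M' \<le> (3/4) ^ k * B / w"
    proof -
      have "w * M' \<le> (3/4) ^ k * B" using 1(2) regular_nonneg[OF 1(1)] by linarith
      then show ?thesis using w by (simp add: pos_le_divide_eq mult.commute)
    qed
    also have "\<dots> \<le> (4/3 * q ^ n) * B / w"
    proof (intro divide_right_mono mult_right_mono)
      \<comment> \<open>The incomplete last block of \<open>n mod N\<close> steps loses at most a
        factor 4/3.\<close>
      have "3/4 \<le> q ^ (n mod N)"
        using power_decreasing[of "n mod N" N q] q N(1) by (simp add: less_imp_le)
      then have "(3/4) ^ k * (3/4) \<le> q ^ (N * k) * q ^ (n mod N)"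
        unfolding power_mult q(3) by (intro mult_left_mono) auto
      also have "\<dots> = q ^ n" by (simp add: k_def flip: power_add)
      finally show "(3/4) ^ k \<le> 4/3 * q ^ n" by simp
    qed (use B w in auto)
    finally show ?thesis by (simp add: ac_simps)
  qed
  with q show ?thesis by blast
qed

text \<open>Gordin's decomposition: \<open>u = (L + L\<^sup>2 + \<cdots>) a\<close> makes \<open>a + u - u \<circ> T\<close> a reverse martingale
  difference.\<close>

theorem martingale_decomposition:
  assumes reg: "regular A M a" and a0: "(\<integral>x. a x \<partial>\<mu>) = 0"
  obtains u where "continuous_on UNIV u" "L (\<lambda>x. a x + u x - u (T x)) = (\<lambda>_. 0)"
proof -
  obtain q C where q: "0 < q" "q < 1" and dec: "\<And>n x. \<bar>(L ^^ n) a x\<bar> \<le> C * q ^ n"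
    using exponential_decay[OF assms] by blast
  have ca: "continuous_on UNIV a" by (rule regular_continuous[OF reg])
  \<comment> \<open>The series starts with \<open>L a\<close>, not with \<open>a\<close>; this shift
    gives \<open>L u = u - L a\<close>.\<close>
  define g where "g n = (L ^^ Suc n) a" for n
  have cg: "continuous_on UNIV (g n)" for n unfolding g_def by (rule continuous_Ln[OF ca])
  define U where "U n x = (\<Sum>i<n. g i x)" for n x
  define u where "u x = (\<Sum>i. g i x)" for x
  have "summable (\<lambda>n. q ^ n)" using q by (intro summable_geometric) auto
  then have "summable (\<lambda>n. q ^ Suc n)" by (rule summable_ignore_initial_segment[of _ 1, unfolded Suc_eq_plus1[symmetric]])
  then have sumq: "summable (\<lambda>n. C * q ^ Suc n)" by (rule summable_mult)
  have ul: "uniform_limit UNIV U u sequentially"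
    unfolding U_def u_def
    by (rule Weierstrass_m_test[OF _ sumq]) (simp only: g_def real_norm_def dec)
  have cU: "continuous_on UNIV (U n)" for n unfolding U_def by (intro continuous_on_sum cg)
  have cu: "continuous_on UNIV u"
    using cU by (intro uniform_limit_theorem[OF _ ul]) auto
  have LU: "L (U n) x = U (Suc n) x - L a x" for n x
  proof -
    have "L (U n) = (\<lambda>x. \<Sum>i<n. L (g i) x)"
      unfolding U_def using Ln_sum[of "{..<n}" 1 g] by simp
    moreover have "L (g i) = g (Suc i)" for i by (simp add: g_def)
    ultimately show ?thesis
      unfolding U_def sum.lessThan_Suc_shift by (simp add: g_def)
  qed
  have Lu: "L u x = u x - L a x" for x
  proof (rule LIMSEQ_unique)
    show "(\<lambda>n. L (U n) x) \<longlonglongrightarrow> u x - L a x"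
      unfolding LU using LIMSEQ_Suc[OF tendsto_uniform_limitI[OF ul, of x]] by (intro tendsto_intros) auto
    \<comment> \<open>\<open>L\<close> does not increase the sup norm, so it may be applied to the
      uniform limit.\<close>
    show "(\<lambda>n. L (U n) x) \<longlonglongrightarrow> L u x"
    proof (rule tendstoI)
      fix e :: real assume "e > 0"
      then have "\<forall>\<^sub>F n in sequentially. \<forall>x. \<bar>U n x - u x\<bar> < e / 2"
        using uniform_limitD[OF ul, of "e / 2"] by (simp add: dist_real_def)
      then show "\<forall>\<^sub>F n in sequentially. dist (L (U n) x) (L u x) < e"
      proof eventually_elim
        case (elim n)
        have "\<bar>L (\<lambda>x. U n x - u x) x\<bar> \<le> e / 2" by (rule L_abs_le) (use elim less_imp_le in blast)
        then show ?case using \<open>e > 0\<close> by (simp add: L_diff dist_real_def)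
      qed
    qed
  qed
  \<comment> \<open>With this, the image under \<open>L\<close> is
    \<open>L a + (u - L a) - u = 0\<close>.\<close>
  have "L (\<lambda>x. u (T x)) = u" using L_pull[of "\<lambda>_. 1" u] by (simp add: L_1)
  then have "L (\<lambda>x. a x + u x - u (T x)) = (\<lambda>_. 0)"
    using L_diff[of "\<lambda>x. a x + u x" "\<lambda>x. u (T x)"] L_add[of a u] by (simp add: Lu)
  with cu that show ?thesis by blast
qed

end

section \<open>Admissible maps and compatible moduli\<close>

text \<open>The lift repeats \<open>F x = x * (1 + V x)\<close> on each unit interval, raised by
  \<open>q = V 1 + 1\<close> per turn. Expansion comes from positivity and monotonicity of
  \<open>V\<close>, with factor \<open>1 + V c\<close> to the right of \<open>c\<close>.\<close>

lemma circle_lift_circle_map: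
  assumes "admissible V"
  obtains G q where "circle_lift G (circle_map V) q"
proof -
  obtain p :: nat where p: "p > 0" "V 1 = real p" using assms by (auto simp: admissible_def)
  have cV: "continuous_on {0..} V" and nonneg: "\<And>x. 0 \<le> x \<Longrightarrow> 0 \<le> V x"
    and rv: "regularly_varying_at_0 V" using assms by (auto simp: admissible_def)
  have mono: "V x \<le> V y" if "0 \<le> x" "x \<le> y" for x y
    using assms that mono_onD[of "{0..}" V x y] by (simp add: admissible_def)
  \<comment> \<open>If \<open>V\<close> vanished at some \<open>x > 0\<close>, it would vanish on
    (0, x). The quotient in regular variation at \<open>t = 1\<close> would then be 0/0, which is 0
    by convention, against the limit 1.\<close>
  have pos: "V x > 0" if "x > 0" for x
  proof (rule ccontr)
    assume "\<not> V x > 0"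
    then have Vx: "V x = 0" using nonneg[of x] that by simp
    obtain \<sigma> where "((\<lambda>y. V (1 * y) / V y) \<longlongrightarrow> 1 powr \<sigma>) (at_right 0)"
      using rv zero_less_one unfolding regularly_varying_at_0_def by blast
    moreover have "\<forall>\<^sub>F y in at_right 0. V (1 * y) / V y = 0"
      using eventually_at_right_real[OF that]
    proof eventually_elim
      case (elim y)
      then have "V y = 0" using mono[of y x] nonneg[of y] Vx by simp
      then show ?case by simp
    qed
    ultimately have "((\<lambda>y::real. 0::real) \<longlongrightarrow> 1 powr \<sigma>) (at_right 0)"
      by (rule Lim_transform_eventually)
    then have "(0::real) = 1 powr \<sigma>"
      by (intro tendsto_unique[OF _ tendsto_const]) auto
    then show False by simp
  qed
  define F where "F x = x * (1 + V x)" for x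
  define q where "q = Suc p"
  define G where "G t = real q * of_int \<lfloor>t\<rfloor> + F (frac t)" for t :: real
  have F01: "F 0 = 0" "F 1 = real q" by (auto simp: F_def p q_def)
  have Fexp: "(y - x) * (1 + V y) \<le> F y - F x" if "0 \<le> x" "x \<le> y" for x y
  proof -
    have "F y - F x - (y - x) * (1 + V y) = x * (V y - V x)" by (simp add: F_def algebra_simps)
    also have "\<dots> \<ge> 0" using that mono[of x y] by simp
    finally show ?thesis by simp
  qed
  have Fstrict: "y - x < F y - F x" if "0 \<le> x" "x < y" for x y
  proof -
    have "y - x = (y - x) * 1" by simp
    also have "\<dots> < (y - x) * (1 + V y)" using that pos[of y] by (intro mult_strict_left_mono) auto
    also have "\<dots> \<le> F y - F x" using that by (intro Fexp) auto
    finally show ?thesis .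
  qed
  \<comment> \<open>Both endpoints are allowed because \<open>F 1 = q\<close> makes adjacent pieces
    agree; continuity of \<open>G\<close> is glued from these closed pieces.\<close>
  have G_unit: "G t = real q * of_int k + F (t - of_int k)" if "of_int k \<le> t" "t \<le> of_int k + 1" for k t
  proof (cases "t = of_int k + 1")
    case True
    then show ?thesis by (simp add: G_def F01 algebra_simps)
  next
    case False
    then have "\<lfloor>t\<rfloor> = k" using that by (simp add: floor_eq_iff)
    then show ?thesis by (simp add: G_def frac_def)
  qed
  have cF: "continuous_on {0..} F" unfolding F_def by (intro continuous_intros cV)
  have cont_piece: "continuous_on {real_of_int k..of_int k + 1} G" for k
  proof -
    have "continuous_on {real_of_int k..of_int k + 1} (\<lambda>t. real q * of_int k + F (t - of_int k))"
      by (intro continuous_intros continuous_on_compose2[OF cF]) auto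
    then show ?thesis by (rule continuous_on_eq) (simp add: G_unit[of k])
  qed
  have "circle_lift G (circle_map V) q"
  proof
    show "continuous_on UNIV G"
      unfolding continuous_on_eq_continuous_at[OF open_UNIV]
    proof
      fix t :: real
      define k where "k = \<lfloor>t\<rfloor>"
      have "continuous_on ({real_of_int (k - 1)..of_int (k - 1) + 1} \<union> {real_of_int k..of_int k + 1}) G"
        by (intro continuous_on_closed_Un cont_piece closed_atLeastAtMost)
      moreover have "{real_of_int (k - 1)..of_int (k - 1) + 1} \<union> {real_of_int k..of_int k + 1} = {of_int k - 1..of_int k + 1}"
        by auto
      moreover have "t \<in> interior {of_int k - 1..of_int k + 1}"
        unfolding k_def interior_atLeastAtMost_real greaterThanLessThan_iff by linarith
      ultimately show "isCont G t" by (metis continuous_on_interior)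
    qed
    show "G 0 = 0" by (simp add: G_def F01)
    show "G (t + 1) = G t + real q" for t
      by (simp add: G_def frac_def algebra_simps)
    show "2 \<le> q" using p by (simp add: q_def)
    show "circle_map V (proj t) = proj (G t)" for t
    proof -
      have "circle_map V (proj t) = proj (F (frac t))" unfolding circle_map_def coord_proj F_def by (rule proj_def[symmetric])
      also have "\<dots> = proj (F (frac t) + of_int (int q * \<lfloor>t\<rfloor>))" by (simp only: proj_add_of_int)
      also have "\<dots> = proj (G t)" by (simp add: G_def add.commute)
      finally show ?thesis .
    qed
    show "y - x < G y - G x" if "x < y" for x y
    proof -
      define k l where "k = \<lfloor>x\<rfloor>" and "l = \<lfloor>y\<rfloor>"
      define a b where "a = frac x" and "b = frac y"
      have ab: "0 \<le> a" "a < 1" "0 \<le> b" "b < 1" by (auto simp: a_def b_def frac_lt_1)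
      have xy: "x = of_int k + a" "y = of_int l + b" by (auto simp: k_def l_def a_def b_def frac_def)
      have diff: "G y - G x = real q * of_int (l - k) + (F b - F a)"
        by (simp add: G_def k_def l_def a_def b_def algebra_simps)
      show ?thesis
      proof (cases "k = l")
        case True
        then show ?thesis unfolding diff using Fstrict[of a b] ab xy that by simp
      next
        case False
        \<comment> \<open>The segment from \<open>x\<close> to \<open>y\<close> is cut at integers
          into lengths \<open>1 - a\<close>, \<open>l - k - 1\<close> and \<open>b\<close>. The
          first is strictly expanded and the other two are not shortened.\<close>
        then have kl: "k + 1 \<le> l" using that floor_mono[of x y] by (simp add: k_def l_def)
        have "real_of_int (l - k) - 1 \<le> real q * (real_of_int (l - k) - 1)"
          using kl by (intro mult_right_mono[of 1 "real q", simplified]) (auto simp: q_def)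
        moreover have "b \<le> F b" using Fstrict[of 0 b] ab F01 by (cases "b = 0") auto
        moreover have "1 - a < real q - F a" using Fstrict[of a 1] ab F01 by simp
        moreover have "y - x = of_int (l - k) + b - a" using xy by simp
        ultimately show ?thesis unfolding diff by (simp add: algebra_simps)
      qed
    qed
    show "\<exists>\<Lambda>>1. \<forall>x\<in>{c..1}. \<forall>y\<in>{c..1}. x \<le> y \<longrightarrow> \<Lambda> * (y - x) \<le> G y - G x" if "0 < c" for c
    proof (intro exI[of _ "1 + V c"] conjI ballI impI)
      show "1 < 1 + V c" using pos[OF that] by simp
      fix x y assume xy: "x \<in> {c..1}" "y \<in> {c..1}" "x \<le> y"
      then have "G y - G x = F y - F x" using G_unit[of 0 x] G_unit[of 0 y] that by simp
      moreover have "(1 + V c) * (y - x) \<le> (1 + V y) * (y - x)"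
        using xy that mono[of c y] by (intro mult_right_mono) auto
      ultimately show "(1 + V c) * (y - x) \<le> G y - G x"
        using Fexp[of x y] xy that by (simp add: mult.commute)
    qed
  qed
  then show ?thesis using that by blast
qed

section \<open>Moduli of continuity and their behaviour along inverse branches\<close>

lemma C_mod_bound:
  assumes "a \<in> C_mod \<Omega>" "modulus \<Omega>"
  obtains A where "A \<ge> 0" "\<And>x y. \<bar>a x - a y\<bar> \<le> A * \<Omega> (dist x y)"
proof -
  have fin: "modulus_seminorm \<Omega> a < \<infinity>" using assms by (simp add: C_mod_def)
  then have "\<exists>B. modulus_seminorm \<Omega> a \<le> ereal B" by (cases "modulus_seminorm \<Omega> a") auto
  then obtain B where B: "modulus_seminorm \<Omega> a \<le> ereal B" by blast
  show ?thesis
  proof (rule that[of "max B 0"])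
    fix x y
    show "\<bar>a x - a y\<bar> \<le> max B 0 * \<Omega> (dist x y)"
    proof (cases "x = y")
      case True
      then show ?thesis using assms by (simp add: modulus_def)
    next
      case False
      have pos: "\<Omega> (dist x y) > 0" using assms False by (simp add: modulus_def)
      have "ereal (\<bar>a x - a y\<bar> / \<Omega> (dist x y)) \<le> modulus_seminorm \<Omega> a"
        unfolding modulus_seminorm_def using False by (intro SUP_upper2[of "(x, y)"]) auto
      then have "\<bar>a x - a y\<bar> / \<Omega> (dist x y) \<le> B" using B by (meson ereal_less_eq(3) order_trans)
      then have "\<bar>a x - a y\<bar> \<le> B * \<Omega> (dist x y)" using pos by (simp add: pos_divide_le_eq)
      also have "\<dots> \<le> max B 0 * \<Omega> (dist x y)" using pos by (intro mult_right_mono) auto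
      finally show ?thesis .
    qed
  qed simp
qed

text \<open>Orderly vanishing only compares \<open>\<Omega> (\<xi> d)\<close> with \<open>\<Omega> d\<close> for one small \<open>\<xi>\<close>. Applied at the larger
  scale \<open>d / \<xi>\<close> it forces a definite growth of \<open>\<Omega>\<close> beyond \<open>d\<close>, which concavity transports to the left
  of \<open>d\<close>.\<close>

lemma modulus_contraction:
  assumes "modulus \<Omega>" "concave_on {0..} \<Omega>" "vanishes_orderly \<Omega>" "0 < \<eta>" "\<eta> < 1"
  obtains \<theta> \<rho> where "0 \<le> \<theta>" "\<theta> < 1" "\<rho> > 0" "\<And>d. \<lbrakk>0 < d; d < \<rho>\<rbrakk> \<Longrightarrow> \<Omega> (\<eta> * d) \<le> \<theta> * \<Omega> d"
proof -
  have mono: "\<Omega> x \<le> \<Omega> y" if "0 \<le> x" "x \<le> y" for x y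
    using assms(1) that mono_onD[of "{0..}" \<Omega> x y] by (simp add: modulus_def)
  have pos: "\<Omega> x > 0" if "0 < x" for x using assms(1) that by (simp add: modulus_def)
  have "\<forall>\<^sub>F x in at_right 0. (SUP d\<in>{0<..<1/2}. \<Omega> (d * x) / \<Omega> d) < 1/2"
    using assms(3) unfolding vanishes_orderly_def by (rule order_tendstoD(2)) simp
  moreover have "\<forall>\<^sub>F x in at_right 0. x \<in> {0<..<1::real}"
    by (rule eventually_at_right_real) simp
  ultimately have "\<forall>\<^sub>F x in at_right 0. (SUP d\<in>{0<..<1/2}. \<Omega> (d * x) / \<Omega> d) < 1/2 \<and> x \<in> {0<..<1::real}"
    by eventually_elim auto
  then obtain \<xi> :: real where \<xi>: "0 < \<xi>" "\<xi> < 1" and sup: "(SUP d\<in>{0<..<1/2}. \<Omega> (d * \<xi>) / \<Omega> d) < 1/2"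
    using eventually_happens'[of "at_right (0::real)"] by auto
  have half: "\<Omega> (d * \<xi>) \<le> \<Omega> d / 2" if d: "0 < d" "d < 1/2" for d
  proof -
    have "\<Omega> (d * \<xi>) / \<Omega> d \<le> (SUP d\<in>{0<..<1/2}. \<Omega> (d * \<xi>) / \<Omega> d)"
    proof (rule cSUP_upper)
      \<comment> \<open>By monotonicity the quotients are at most 1, so the real supremum is a true
        upper bound.\<close>
      show "bdd_above ((\<lambda>d. \<Omega> (d * \<xi>) / \<Omega> d) ` {0<..<1/2})"
      proof (rule bdd_aboveI2[of _ _ 1])
        fix d :: real assume "d \<in> {0<..<1/2}"
        then have "d * \<xi> \<le> d" "0 \<le> d * \<xi>" "\<Omega> d > 0" using \<xi> pos by (auto simp: mult_left_le)
        then show "\<Omega> (d * \<xi>) / \<Omega> d \<le> 1" using mono[of "d * \<xi>" d] by simp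
      qed
    qed (use d in auto)
    then have "\<Omega> (d * \<xi>) / \<Omega> d < 1/2" using sup by linarith
    then show ?thesis using pos[OF d(1)] by (simp add: field_simps)
  qed
  \<comment> \<open>The weight for which \<open>d\<close> is the convex combination of
    \<open>\<eta> * d\<close> and \<open>d / \<xi>\<close>.\<close>
  define l where "l = (1 - \<xi>) / (1 - \<eta> * \<xi>)"
  have \<eta>\<xi>: "\<eta> * \<xi> < \<xi>" using assms(5) \<xi> by simp
  have "1 - \<xi> < 1 - \<eta> * \<xi>" "0 < 1 - \<xi>" using \<eta>\<xi> \<xi> by linarith+
  then have l: "0 < l" "l < 1" and l_mult: "(1 - \<eta> * \<xi>) * l = 1 - \<xi>" unfolding l_def by (simp_all add: divide_less_eq)
  have contr: "\<Omega> (\<eta> * d) \<le> (2 - 1 / l) * \<Omega> d" if d: "0 < d" "d < \<xi> / 2" for d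
  proof -
    define D where "D = d / \<xi>"
    have D: "0 < D" "D < 1/2" "d = D * \<xi>" using d \<xi> by (auto simp: D_def field_simps)
    have conv: "l * (\<eta> * d) + (1 - l) * D = d"
    proof -
      have "D * (1 - (1 - \<eta> * \<xi>) * l) = D * \<xi>" by (simp add: l_mult)
      then show ?thesis unfolding D(3) by (simp add: algebra_simps)
    qed
    have cx: "convex_on {0..} (\<lambda>x. - \<Omega> x)" using assms(2) by (simp add: concave_on_def)
    have "- \<Omega> ((1 - (1 - l)) *\<^sub>R (\<eta> * d) + (1 - l) *\<^sub>R D) \<le> (1 - (1 - l)) * (- \<Omega> (\<eta> * d)) + (1 - l) * (- \<Omega> D)"
      by (rule convex_onD[OF cx]) (use l D d assms(4) in auto)
    then have "l * \<Omega> (\<eta> * d) + (1 - l) * \<Omega> D \<le> \<Omega> d" using conv by simp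
    moreover have "(1 - l) * (2 * \<Omega> d) \<le> (1 - l) * \<Omega> D"
      using half[OF D(1,2)] l by (intro mult_left_mono) (auto simp: D(3))
    ultimately have "l * \<Omega> (\<eta> * d) \<le> (2 * l - 1) * \<Omega> d" by (simp add: algebra_simps)
    then show ?thesis using l by (simp add: field_simps)
  qed
  show ?thesis
  proof (rule that[of "2 - 1 / l" "\<xi> / 2"])
    \<comment> \<open>Nonnegativity of the factor is read off from the inequality itself at one
      admissible point, where \<open>\<Omega>\<close> is positive.\<close>
    have "0 \<le> \<Omega> (\<eta> * (\<xi> / 4))" using pos[of "\<eta> * (\<xi> / 4)"] \<xi> assms(4) by simp
    also have "\<dots> \<le> (2 - 1 / l) * \<Omega> (\<xi> / 4)" using contr[of "\<xi> / 4"] \<xi> by simp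
    finally show "0 \<le> 2 - 1 / l" using pos[of "\<xi> / 4"] \<xi> by (simp add: zero_le_mult_iff)
    show "2 - 1 / l < 1" using l by (simp add: field_simps)
  qed (use \<xi> contr in auto)
qed

text \<open>Since preimages are separated, the pairing of pre-orbits given by compatibility is the one by
  inverse branches.\<close>

lemma (in circle_lift) compatible_branches:
  assumes "compatible T \<Omega> \<omega>"
  obtains \<rho> C where "\<rho> > 0" "C > 0"
    "\<And>s t j. \<bar>s - t\<bar> < \<rho> \<Longrightarrow> C * \<omega> (dist (branch j s) (branch j t)) \<le> \<Omega> \<bar>s - t\<bar> - \<Omega> (dist (branch j s) (branch j t))"
proof -
  obtain \<rho>0 C where C: "\<rho>0 > 0" "C > 0" and pairing: "\<And>x0 y0. dist x0 y0 < \<rho>0 \<Longrightarrow>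
        (\<exists>B. bij_betw B (pre_orbits T x0) (pre_orbits T y0) \<and>
          (\<forall>x\<in>pre_orbits T x0. \<forall>k.
             dist (x k) (B x k) \<le> dist x0 y0 \<and>
             C * (\<Sum>j=1..k. \<omega> (dist (x j) (B x j)))
               \<le> \<Omega> (dist x0 y0) - \<Omega> (dist (x k) (B x k))))"
    using assms unfolding compatible_def by blast
  obtain \<delta> where \<delta>: "\<delta> > 0" "\<And>x y. \<lbrakk>T x = T y; dist x y < \<delta>\<rbrakk> \<Longrightarrow> x = y" using preimages_separated by metis
  show ?thesis
  \<comment> \<open>The bound 1/2 makes the circle distance equal to
    \<open>\<bar>s - t\<bar>\<close>, and \<open>\<delta> / 2\<close> leaves room for a triangle
    inequality.\<close>
  proof (rule that[of "min \<rho>0 (min (\<delta> / 2) (1 / 2))" C])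
    fix s t :: real and j
    assume st: "\<bar>s - t\<bar> < min \<rho>0 (min (\<delta> / 2) (1 / 2))"
    define d where "d = \<bar>s - t\<bar>"
    have d: "dist (proj s) (proj t) = d" unfolding d_def using st by (intro dist_proj_eq) auto
    \<comment> \<open>Some pre-orbit through \<open>branch j s\<close>: beyond the first step,
      preimages are chosen arbitrarily, and compatibility is read at \<open>k = 1\<close>.\<close>
    define X where "X = case_nat (proj s) (\<lambda>k. (inv T ^^ k) (branch j s))"
    have X: "X \<in> pre_orbits T (proj s)"
    proof -
      have "T (X (Suc k)) = X k" for k
        by (cases k) (simp_all add: X_def T_branch surj_f_inv_f[OF surj_T])
      then show ?thesis by (simp add: pre_orbits_def X_def)
    qed
    have X1: "X 1 = branch j s" by (simp add: X_def)
    obtain B where B: "bij_betw B (pre_orbits T (proj s)) (pre_orbits T (proj t))"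
      and BX: "\<And>k. dist (X k) (B X k) \<le> d \<and>
        C * (\<Sum>j=1..k. \<omega> (dist (X j) (B X j))) \<le> \<Omega> d - \<Omega> (dist (X k) (B X k))"
      using pairing[of "proj s" "proj t"] d st X unfolding d_def by fastforce
    have dX: "dist (branch j s) (B X 1) \<le> d" using BX by (metis X1)
    have "B X \<in> pre_orbits T (proj t)" using B X by (metis bij_betwE)
    then have "T (B X (Suc 0)) = B X 0" "B X 0 = proj t" by (auto simp: pre_orbits_def)
    then have "T (B X 1) = T (branch j t)" by (simp add: T_branch)
    moreover have "dist (B X 1) (branch j t) < \<delta>"
      using dist_triangle3[of "B X 1" "branch j t" "branch j s"] dX dist_branch_le[of j s t] st
      by (simp add: X1 d_def)
    ultimately have "B X 1 = branch j t" by (rule \<delta>(2))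
    then show "C * \<omega> (dist (branch j s) (branch j t)) \<le> \<Omega> \<bar>s - t\<bar> - \<Omega> (dist (branch j s) (branch j t))"
      using BX[of 1] X1 by (simp add: d_def)
  qed (use C \<delta> in auto)
qed

section \<open>The normalised transfer operator of an equilibrium state\<close>

lemma abs_mult_diff_le:
  fixes a b a' b' :: real
  assumes "\<bar>a\<bar> \<le> P" "\<bar>b'\<bar> \<le> Q" "\<bar>a - a'\<bar> \<le> u" "\<bar>b - b'\<bar> \<le> v"
  shows "\<bar>a * b - a' * b'\<bar> \<le> P * v + Q * u"
proof -
  have "a * b - a' * b' = a * (b - b') + b' * (a - a')" by (simp add: algebra_simps)
  also have "\<bar>\<dots>\<bar> \<le> \<bar>a\<bar> * \<bar>b - b'\<bar> + \<bar>b'\<bar> * \<bar>a - a'\<bar>"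
    by (rule order_trans[OF abs_triangle_ineq]) (simp add: abs_mult)
  also have "\<dots> \<le> P * v + Q * u" using assms by (intro add_mono mult_mono) auto
  finally show ?thesis .
qed

lemma exp_diff_le:
  fixes a b :: real
  assumes "a \<le> F" "b \<le> F" shows "\<bar>exp a - exp b\<bar> \<le> exp F * \<bar>a - b\<bar>"
proof -
  have *: "exp x - exp y \<le> exp F * (x - y)" if "y \<le> x" "x \<le> F" for x y :: real
  proof -
    have "exp x * (1 + (y - x)) \<le> exp x * exp (y - x)"
      by (intro mult_left_mono exp_ge_add_one_self) simp
    also have "\<dots> = exp y" by (simp flip: exp_add)
    finally have "exp x - exp y \<le> exp x * (x - y)" by (simp add: algebra_simps)
    also have "\<dots> \<le> exp F * (x - y)" using that by (intro mult_right_mono) auto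
    finally show ?thesis .
  qed
  show ?thesis using *[of a b] *[of b a] assms by (cases "a \<le> b") (auto simp: abs_if)
qed

lemma transfer_op_add: "transfer_op T f (\<lambda>y. a y + b y) x = transfer_op T f a x + transfer_op T f b x"
  by (simp add: transfer_op_def distrib_left sum.distrib)

lemma transfer_op_scale: "transfer_op T f (\<lambda>y. c * a y) x = c * transfer_op T f a x"
  by (simp add: transfer_op_def sum_distrib_left mult.left_commute)

lemma transfer_op_mono: "(\<And>y. a y \<le> b y) \<Longrightarrow> transfer_op T f a x \<le> transfer_op T f b x"
  by (simp add: transfer_op_def sum_mono mult_left_mono)

lemma transfer_op_pull: "transfer_op T f (\<lambda>y. a y * b (T y)) x = transfer_op T f a x * b x"
  unfolding transfer_op_def sum_distrib_right by (intro sum.cong) auto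

section \<open>Normalisation by the eigenfunction\<close>

locale circle_equilibrium = circle_lift G T q
  for G :: "real \<Rightarrow> real" and T :: "circle \<Rightarrow> circle" and q :: nat +
  fixes f h :: "circle \<Rightarrow> real" and \<omega> \<Omega> :: "real \<Rightarrow> real" and \<kappa> :: real and \<nu> \<mu> :: "circle measure"
  assumes modulus_omega: "modulus \<omega>" and modulus_Omega: "modulus \<Omega>"
    and compatible: "compatible T \<Omega> \<omega>"
    and concave: "concave_on {0..} \<Omega>" and orderly: "vanishes_orderly \<Omega>"
    and f_reg: "f \<in> C_mod \<omega>" and RPF: "RPF_data T f \<Omega> \<kappa> h \<nu>"
    and mu_eq: "\<mu> = density \<nu> (\<lambda>x. ennreal (h x))" and invariant: "invariant_prob T \<mu>"
begin

lemma kappa_pos: "\<kappa> > 0" and h_reg: "h \<in> C_mod \<Omega>" and h_pos: "h x > 0"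
  and sets_nu: "sets \<nu> = sets borel"
  and transfer_h: "transfer_op T f h = (\<lambda>x. \<kappa> * h x)"
  and dual_nu: "continuous_on UNIV a \<Longrightarrow> (\<integral>x. transfer_op T f a x \<partial>\<nu>) = \<kappa> * (\<integral>x. a x \<partial>\<nu>)"
  and RPF_limit: "continuous_on UNIV a \<Longrightarrow>
     uniform_limit UNIV (\<lambda>n x. (transfer_op T f ^^ n) a x / \<kappa> ^ n) (\<lambda>x. h x * (\<integral>y. a y \<partial>\<nu>)) sequentially"
  using RPF by (auto simp: RPF_data_def)

lemma continuous_f: "continuous_on UNIV f" and continuous_h: "continuous_on UNIV h"
  using f_reg h_reg by (auto simp: C_mod_def)

definition L :: "(circle \<Rightarrow> real) \<Rightarrow> circle \<Rightarrow> real" where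
  "L a x = transfer_op T f (\<lambda>y. h y * a y) x / (\<kappa> * h x)"

text \<open>The transition probability from \<open>proj t\<close> to its preimage on branch
  \<open>j\<close>.\<close>

definition weight :: "nat \<Rightarrow> real \<Rightarrow> real" where
  "weight j t = exp (f (branch j t)) * h (branch j t) / (\<kappa> * h (proj t))"

lemma L_proj: "L a (proj t) = (\<Sum>j<q. weight j t * a (branch j t))"
  by (simp add: L_def transfer_op_def sum_preimages weight_def sum_divide_distrib mult.assoc)

lemma weight_pos: "weight j t > 0"
  using h_pos kappa_pos by (simp add: weight_def)

lemma sum_weight: "(\<Sum>j<q. weight j t) = 1"
proof -
  have "L (\<lambda>_. 1) (proj t) = 1"
    using transfer_h h_pos[of "proj t"] kappa_pos by (simp add: L_def)
  then show ?thesis by (simp add: L_proj)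
qed

lemma continuous_weight: "continuous_on UNIV (weight j)"
proof -
  have "continuous_on UNIV (\<lambda>t. a (branch j t))" if "continuous_on UNIV a" for a :: "circle \<Rightarrow> real"
    by (rule continuous_on_compose2[OF that continuous_on_branch]) auto
  moreover have "continuous_on UNIV (\<lambda>t. h (proj t))"
    by (rule continuous_on_compose2[OF continuous_h continuous_on_proj]) auto
  moreover have "\<kappa> * h (proj t) \<noteq> 0" for t using kappa_pos h_pos[of "proj t"] by simp
  ultimately show ?thesis
    unfolding weight_def by (intro continuous_intros) (auto simp: continuous_f continuous_h)
qed

lemma continuous_L:
  assumes "continuous_on UNIV a" shows "continuous_on UNIV (L a)"
proof (rule continuous_on_circle)
  have "continuous_on UNIV (\<lambda>t. a (branch j t))" for j
    by (rule continuous_on_compose2[OF assms continuous_on_branch]) auto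
  then show "continuous_on UNIV (\<lambda>t. L a (proj t))"
    unfolding L_proj by (intro continuous_intros continuous_weight)
qed

text \<open>\<open>L\<close> is the transfer operator conjugated by multiplication with
  \<open>h\<close> and divided by \<open>\<kappa>\<close>, so the inner factors \<open>h\<close>
  cancel under iteration.\<close>

lemma L_funpow: "(L ^^ n) a = (\<lambda>x. (transfer_op T f ^^ n) (\<lambda>y. h y * a y) x / \<kappa> ^ n / h x)"
proof (induction n)
  case 0
  then show ?case using h_pos by (auto simp: less_imp_neq[symmetric])
next
  case (Suc n)
  define Z where "Z = (transfer_op T f ^^ n) (\<lambda>y. h y * a y)"
  have "(\<lambda>y. h y * (Z y / \<kappa> ^ n / h y)) = (\<lambda>y. inverse (\<kappa> ^ n) * Z y)"
    using h_pos by (auto simp: less_imp_neq[symmetric] field_simps)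
  then have "L (\<lambda>y. Z y / \<kappa> ^ n / h y) x = inverse (\<kappa> ^ n) * transfer_op T f Z x / (\<kappa> * h x)" for x
    by (simp only: L_def transfer_op_scale)
  then show ?case using Suc by (simp add: Z_def field_simps)
qed

lemma bounds:
  obtains m M where "0 < m" "\<And>x. m \<le> h x" "\<And>x. h x \<le> M" "\<And>x. \<bar>f x\<bar> \<le> M"
proof -
  obtain x0 where x0: "\<And>x. h x0 \<le> h x"
    using continuous_attains_inf[OF compact_circle _ continuous_h] by auto
  have "bounded (range h)" "bounded (range f)"
    by (auto intro!: compact_imp_bounded compact_continuous_image continuous_h continuous_f compact_circle)
  then obtain M1 M2 where "\<And>x. \<bar>h x\<bar> \<le> M1" "\<And>x. \<bar>f x\<bar> \<le> M2"
    unfolding bounded_iff by auto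
  then show ?thesis using that[of "h x0" "max M1 M2"] x0 h_pos by (metis abs_le_D1 max.coboundedI1 max.coboundedI2)
qed

lemma measurable_nu: "continuous_on UNIV a \<Longrightarrow> a \<in> borel_measurable \<nu>" for a :: "circle \<Rightarrow> real"
  using borel_measurable_continuous_onI measurable_cong_sets[OF sets_nu refl] by blast

lemma integral_mu: "continuous_on UNIV a \<Longrightarrow> (\<integral>x. a x \<partial>\<mu>) = (\<integral>x. h x * a x \<partial>\<nu>)" for a :: "circle \<Rightarrow> real"
  unfolding mu_eq using h_pos less_imp_le
  by (subst integral_density) (auto intro!: measurable_nu continuous_h)

text \<open>The eigenfunction equation gives \<open>L 1 = 1\<close>, the dual eigenmeasure equation
  gives preservation of integrals, and the Ruelle-Perron-Frobenius limit divided by \<open>h\<close>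
  gives mixing.\<close>

sublocale normalized_transfer \<mu> T L
proof -
  interpret prob_space \<mu> using invariant by (simp add: invariant_prob_def)
  have pos: "\<kappa> * h x > 0" for x using kappa_pos h_pos by simp
  show "normalized_transfer \<mu> T L"
  proof
    show "compact (UNIV :: circle set)" by (rule compact_circle)
    show "sets \<mu> = sets borel" using invariant by (simp add: invariant_prob_def)
    show "continuous_on UNIV T" by (rule cont_T)
    show "L (\<lambda>x. a x + b x) = (\<lambda>x. L a x + L b x)" for a b
      by (rule ext) (simp add: L_def distrib_left transfer_op_add add_divide_distrib)
    show "L (\<lambda>x. c * a x) = (\<lambda>x. c * L a x)" for c a
      by (rule ext) (simp add: L_def transfer_op_scale mult.left_commute)
    show "L a x \<le> L b x" if "\<And>x. a x \<le> b x" for a b x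
      unfolding L_def using that pos[of x] h_pos
      by (intro divide_right_mono transfer_op_mono mult_left_mono) (auto simp: less_imp_le)
    show "L (\<lambda>_. 1) = (\<lambda>_. 1)"
      using kappa_pos h_pos by (auto simp: L_def transfer_h less_imp_neq[symmetric])
    show "L (\<lambda>x. a x * b (T x)) = (\<lambda>x. L a x * b x)" for a b
      using transfer_op_pull[of T f "\<lambda>y. h y * a y" b] by (auto simp: L_def mult.assoc)
    show "continuous_on UNIV (L a)" if "continuous_on UNIV a" for a
      using that by (rule continuous_L)
    show "(\<integral>x. L a x \<partial>\<mu>) = (\<integral>x. a x \<partial>\<mu>)" if a: "continuous_on UNIV a" for a
    proof -
      have "(\<integral>x. L a x \<partial>\<mu>) = (\<integral>x. h x * L a x \<partial>\<nu>)" by (rule integral_mu[OF continuous_L[OF a]])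
      also have "\<dots> = (\<integral>x. transfer_op T f (\<lambda>y. h y * a y) x / \<kappa> \<partial>\<nu>)"
        using h_pos kappa_pos by (auto simp: L_def less_imp_neq[symmetric] intro!: Bochner_Integration.integral_cong)
      also have "\<dots> = (\<integral>x. h x * a x \<partial>\<nu>)"
        using dual_nu[of "\<lambda>y. h y * a y"] kappa_pos a continuous_h by (simp add: continuous_on_mult)
      finally show ?thesis by (simp add: integral_mu[OF a])
    qed
    show "uniform_limit UNIV (\<lambda>n. (L ^^ n) a) (\<lambda>_. \<integral>x. a x \<partial>\<mu>) sequentially" if a: "continuous_on UNIV a" for a
    proof (rule uniform_limitI)
      fix e :: real assume e: "e > 0"
      obtain m where m: "0 < m" "\<And>x. m \<le> h x" using bounds by metis
      define I where "I = (\<integral>x. a x \<partial>\<mu>)"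
      define Z where "Z n x = (transfer_op T f ^^ n) (\<lambda>y. h y * a y) x / \<kappa> ^ n" for n x
      have "uniform_limit UNIV Z (\<lambda>x. h x * I) sequentially"
        unfolding Z_def I_def integral_mu[OF a]
        by (rule RPF_limit) (intro continuous_intros continuous_h a)
      \<comment> \<open>The tolerance \<open>e * m\<close> becomes at most \<open>e\<close> after
        division by \<open>h\<close>, which is at least \<open>m\<close>.\<close>
      then have "\<forall>\<^sub>F n in sequentially. \<forall>x\<in>UNIV. dist (Z n x) (h x * I) < e * m"
        using e m by (intro uniform_limitD) auto
      then show "\<forall>\<^sub>F n in sequentially. \<forall>x\<in>UNIV. dist ((L ^^ n) a x) (\<integral>x. a x \<partial>\<mu>) < e"
      proof eventually_elim
        case (elim n)
        show ?case
        proof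
          fix x
          have "(L ^^ n) a x - I = (Z n x - h x * I) / h x"
            using h_pos[of x] by (simp add: L_funpow Z_def diff_divide_distrib)
          then have "\<bar>(L ^^ n) a x - I\<bar> = \<bar>Z n x - h x * I\<bar> / h x"
            using h_pos[of x] by (simp add: abs_divide)
          also have "\<dots> < e * m / h x"
            using elim h_pos[of x] by (intro divide_strict_right_mono) (auto simp: dist_real_def)
          also have "\<dots> \<le> e" using m(2)[of x] h_pos[of x] e by (simp add: pos_divide_le_eq)
          finally show "dist ((L ^^ n) a x) (\<integral>x. a x \<partial>\<mu>) < e" by (simp add: dist_real_def I_def)
        qed
      qed
    qed
  qed
qed

section \<open>Regularity of the weights and the Lasota-Yorke inequality\<close>

lemma Omega_mono: "0 \<le> x \<Longrightarrow> x \<le> y \<Longrightarrow> \<Omega> x \<le> \<Omega> y"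
  using modulus_Omega mono_onD[of "{0..}" \<Omega> x y] by (simp add: modulus_def)

lemma Omega_nonneg: "0 \<le> x \<Longrightarrow> 0 \<le> \<Omega> x"
  using Omega_mono[of 0 x] modulus_Omega by (simp add: modulus_def)

text \<open>The potential \<open>f\<close> is only \<open>\<omega>\<close>-regular, but one step of
  compatibility bounds \<open>C * \<omega>\<close> at the preimages by \<open>\<Omega>\<close> at
  the base points. The factors with \<open>h\<close> are \<open>\<Omega>\<close>-regular already,
  and branches do not increase distances.\<close>

lemma weight_lipschitz:
  "\<exists>\<rho>>0. \<exists>K\<ge>0. \<forall>s t j. \<bar>s - t\<bar> < \<rho> \<longrightarrow> \<bar>weight j s - weight j t\<bar> \<le> K * \<Omega> \<bar>s - t\<bar>"
proof -
  obtain \<rho> C where C: "\<rho> > 0" "C > 0" and comp: "\<And>s t j. \<bar>s - t\<bar> < \<rho> \<Longrightarrow>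
      C * \<omega> (dist (branch j s) (branch j t)) \<le> \<Omega> \<bar>s - t\<bar> - \<Omega> (dist (branch j s) (branch j t))"
    using compatible_branches[OF compatible] by metis
  obtain Af where Af: "Af \<ge> 0" "\<And>x y. \<bar>f x - f y\<bar> \<le> Af * \<omega> (dist x y)"
    using C_mod_bound[OF f_reg modulus_omega] by metis
  obtain Ah where Ah: "Ah \<ge> 0" "\<And>x y. \<bar>h x - h y\<bar> \<le> Ah * \<Omega> (dist x y)"
    using C_mod_bound[OF h_reg modulus_Omega] by metis
  obtain m M where m: "0 < m" "\<And>x. m \<le> h x" and M: "\<And>x. h x \<le> M" "\<And>x. \<bar>f x\<bar> \<le> M"
    using bounds by metis
  have M0: "M \<ge> 0" using M(2) abs_ge_zero order_trans by blast
  define K where "K = (exp M * M) * (Ah / (\<kappa> * m\<^sup>2)) + 1 / (\<kappa> * m) * (exp M * Ah + M * (exp M * Af / C))"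
  have "K \<ge> 0" using m(1) M0 Af(1) Ah(1) C(2) kappa_pos by (simp add: K_def)
  moreover have "\<bar>weight j s - weight j t\<bar> \<le> K * \<Omega> \<bar>s - t\<bar>" if st: "\<bar>s - t\<bar> < \<rho>" for s t j
  proof -
    define d where "d = \<bar>s - t\<bar>"
    define d1 where "d1 = dist (branch j s) (branch j t)"
    have d1: "0 \<le> d1" "d1 \<le> d" using dist_branch_le by (auto simp: d1_def d_def)
    have \<Omega>d1: "\<Omega> d1 \<le> \<Omega> d" "0 \<le> \<Omega> d1" using d1 Omega_mono Omega_nonneg by auto
    have "C * \<omega> d1 \<le> \<Omega> d" using comp[OF st, of j] \<Omega>d1(2) by (simp add: d1_def d_def)
    then have \<omega>d1: "\<omega> d1 \<le> \<Omega> d / C" using C(2) by (simp add: pos_le_divide_eq mult.commute)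
    have fM: "f x \<le> M" for x using M(2)[of x] by linarith
    have "\<bar>exp (f (branch j s)) - exp (f (branch j t))\<bar> \<le> exp M * \<bar>f (branch j s) - f (branch j t)\<bar>"
      by (rule exp_diff_le) (rule fM)+
    also have "\<dots> \<le> exp M * (Af * (\<Omega> d / C))"
    proof (rule mult_left_mono)
      have "\<bar>f (branch j s) - f (branch j t)\<bar> \<le> Af * \<omega> d1" unfolding d1_def by (rule Af(2))
      also have "\<dots> \<le> Af * (\<Omega> d / C)" by (rule mult_left_mono[OF \<omega>d1 Af(1)])
      finally show "\<bar>f (branch j s) - f (branch j t)\<bar> \<le> Af * (\<Omega> d / C)" .
    qed simp
    finally have e: "\<bar>exp (f (branch j s)) - exp (f (branch j t))\<bar> \<le> exp M * (Af * (\<Omega> d / C))" .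
    have hb: "\<bar>h (branch j s) - h (branch j t)\<bar> \<le> Ah * \<Omega> d"
      using Ah(2)[of "branch j s" "branch j t"] mult_left_mono[OF \<Omega>d1(1) Ah(1)] by (simp add: d1_def)
    have habs: "\<bar>h x\<bar> \<le> M" for x using M(1)[of x] h_pos[of x] by simp
    define E where "E s = exp (f (branch j s)) * h (branch j s)" for s
    have Ed: "\<bar>E s - E t\<bar> \<le> exp M * (Ah * \<Omega> d) + M * (exp M * (Af * (\<Omega> d / C)))"
      unfolding E_def by (rule abs_mult_diff_le[OF _ habs e hb]) (simp add: fM)
    have Eb: "\<bar>E s\<bar> \<le> exp M * M" for s
      unfolding E_def abs_mult using fM habs by (intro mult_mono) auto
    define R where "R s = 1 / (\<kappa> * h (proj s))" for s
    have Rb: "\<bar>R s\<bar> \<le> 1 / (\<kappa> * m)" for s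
      using m h_pos[of "proj s"] kappa_pos by (simp add: R_def frac_le)
    have hd: "\<bar>h (proj t) - h (proj s)\<bar> \<le> Ah * \<Omega> d"
    proof -
      have "\<bar>h (proj t) - h (proj s)\<bar> \<le> Ah * \<Omega> (dist (proj t) (proj s))" by (rule Ah(2))
      also have "\<dots> \<le> Ah * \<Omega> d"
        using dist_proj_le[of t s] Ah(1) by (intro mult_left_mono Omega_mono) (auto simp: d_def)
      finally show ?thesis .
    qed
    have "\<bar>R s - R t\<bar> = \<bar>h (proj t) - h (proj s)\<bar> / (\<kappa> * (h (proj s) * h (proj t)))"
    proof -
      have "R s - R t = (h (proj t) - h (proj s)) / (\<kappa> * (h (proj s) * h (proj t)))"
        using h_pos[of "proj s"] h_pos[of "proj t"] kappa_pos by (simp add: R_def field_simps)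
      then show ?thesis using h_pos[of "proj s"] h_pos[of "proj t"] kappa_pos by (simp add: abs_mult)
    qed
    also have "\<dots> \<le> (Ah * \<Omega> d) / (\<kappa> * m\<^sup>2)"
    proof (rule frac_le[OF _ hd])
      show "\<kappa> * m\<^sup>2 \<le> \<kappa> * (h (proj s) * h (proj t))"
        unfolding power2_eq_square using m h_pos kappa_pos less_imp_le by (intro mult_left_mono mult_mono) auto
    qed (use Ah(1) Omega_nonneg[of d] m kappa_pos in \<open>auto simp: d_def\<close>)
    finally have Rd: "\<bar>R s - R t\<bar> \<le> (Ah * \<Omega> d) / (\<kappa> * m\<^sup>2)" .
    have "weight j s = E s * R s" for s by (simp add: weight_def E_def R_def)
    then have "\<bar>weight j s - weight j t\<bar> \<le> exp M * M * ((Ah * \<Omega> d) / (\<kappa> * m\<^sup>2))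
        + 1 / (\<kappa> * m) * (exp M * (Ah * \<Omega> d) + M * (exp M * (Af * (\<Omega> d / C))))"
      using abs_mult_diff_le[OF Eb Rb Ed Rd] by simp
    also have "\<dots> = K * \<Omega> d" by (simp add: K_def algebra_simps)
    finally show ?thesis by (simp add: d_def)
  qed
  ultimately show ?thesis using C(1) by blast
qed

text \<open>Differences of \<open>a\<close> are averaged with the weights: one branch contracts
  \<open>\<Omega>\<close> by \<open>\<theta>0\<close>, the others do not increase it. Differences of
  the weights cost \<open>K0\<close> on each of the \<open>q\<close> branches and involve only the
  sup bound.\<close>

lemma lasota_yorke:
  obtains \<rho> \<theta> K where "lasota_yorke \<mu> T L \<Omega> \<rho> \<theta> K"
proof -
  from weight_lipschitz obtain \<rho>1 K0 where \<rho>1: "\<rho>1 > 0" "K0 \<ge> 0"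
    and wl: "\<And>s t j. \<bar>s - t\<bar> < \<rho>1 \<Longrightarrow> \<bar>weight j s - weight j t\<bar> \<le> K0 * \<Omega> \<bar>s - t\<bar>"
    by blast
  have "\<exists>\<eta> \<rho>. 0 < \<eta> \<and> \<eta> < 1 \<and> \<rho> > 0 \<and>
      (\<forall>t s. 0 \<le> t \<longrightarrow> t < 1 \<longrightarrow> \<bar>s - t\<bar> < \<rho> \<longrightarrow> (\<exists>j<q. dist (branch j s) (branch j t) \<le> \<eta> * \<bar>s - t\<bar>))"
    by (rule contracting_branch) blast
  then obtain \<eta> \<rho>2 where \<eta>: "0 < \<eta>" "\<eta> < 1" "\<rho>2 > 0"
    and contr: "\<And>t s. \<lbrakk>0 \<le> t; t < 1; \<bar>s - t\<bar> < \<rho>2\<rbrakk> \<Longrightarrow> \<exists>j<q. dist (branch j s) (branch j t) \<le> \<eta> * \<bar>s - t\<bar>"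
    by blast
  have "\<exists>\<theta> \<rho>. 0 \<le> \<theta> \<and> \<theta> < 1 \<and> \<rho> > 0 \<and> (\<forall>d. 0 < d \<longrightarrow> d < \<rho> \<longrightarrow> \<Omega> (\<eta> * d) \<le> \<theta> * \<Omega> d)"
    by (rule modulus_contraction[OF modulus_Omega concave orderly \<eta>(1,2)]) blast
  then obtain \<theta>0 \<rho>3 where \<theta>0: "0 \<le> \<theta>0" "\<theta>0 < 1" "\<rho>3 > 0"
    and \<Omega>c: "\<And>d. \<lbrakk>0 < d; d < \<rho>3\<rbrakk> \<Longrightarrow> \<Omega> (\<eta> * d) \<le> \<theta>0 * \<Omega> d"
    by blast
  obtain m M where m: "0 < m" "\<And>x. m \<le> h x" and M: "\<And>x. h x \<le> M" "\<And>x. \<bar>f x\<bar> \<le> M"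
    using bounds by metis
  have M0: "M > 0" using m M(1) by (meson less_le_trans)
  \<comment> \<open>A lower bound for all weights, capped at 1. The averaged factor
    \<open>1 - w * (1 - \<theta>0)\<close> then lies in [0, 1).\<close>
  define w where "w = min 1 (exp (- M) * m / (\<kappa> * M))"
  have w: "0 < w" "w \<le> 1" using m M0 kappa_pos by (auto simp: w_def)
  have weight_ge: "w \<le> weight j t" for j t
  proof -
    have "exp (- M) * m / (\<kappa> * M) \<le> weight j t"
      unfolding weight_def
    proof (intro frac_le mult_mono)
      show "exp (- M) \<le> exp (f (branch j t))" using M(2)[of "branch j t"] by (simp add: abs_le_iff)
    qed (use m M M0 h_pos kappa_pos in \<open>auto simp: less_imp_le\<close>)
    then show ?thesis by (simp add: w_def)
  qed
  define \<rho> where "\<rho> = min \<rho>1 (min \<rho>2 \<rho>3)"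
  define \<theta> where "\<theta> = 1 - w * (1 - \<theta>0)"
  define K where "K = real q * K0"
  have "lasota_yorke \<mu> T L \<Omega> \<rho> \<theta> K"
  proof (intro lasota_yorke.intro normalized_transfer_axioms lasota_yorke_axioms.intro)
    show "\<rho> > 0" using \<rho>1 \<eta> \<theta>0 by (simp add: \<rho>_def)
    have "w * (1 - \<theta>0) \<le> 1 * 1" using w \<theta>0 by (intro mult_mono) auto
    then show "0 \<le> \<theta>" by (simp add: \<theta>_def)
    show "\<theta> < 1" using w \<theta>0 by (simp add: \<theta>_def)
    show "K \<ge> 0" using \<rho>1 by (simp add: K_def)
    show "0 \<le> t \<Longrightarrow> 0 \<le> \<Omega> t" for t by (rule Omega_nonneg)
    show "\<exists>r>0. \<forall>t. 0 \<le> t \<longrightarrow> t < r \<longrightarrow> \<Omega> t \<le> \<epsilon>" if "\<epsilon> > 0" for \<epsilon>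
    proof -
      have c: "continuous_on {0..} \<Omega>" and z: "\<Omega> 0 = 0" using modulus_Omega by (auto simp: modulus_def)
      obtain r where r: "r > 0" "\<forall>t\<in>{0..}. dist t 0 < r \<longrightarrow> dist (\<Omega> t) (\<Omega> 0) < \<epsilon>"
        using c[unfolded continuous_on_iff, rule_format, of 0 \<epsilon>] \<open>\<epsilon> > 0\<close> by auto
      have "\<Omega> t \<le> \<epsilon>" if "0 \<le> t" "t < r" for t
        using r(2)[rule_format, of t] that by (simp add: z)
      with r(1) show ?thesis by blast
    qed
    fix a :: "circle \<Rightarrow> real" and B A :: real and x y :: circle
    assume a: "continuous_on UNIV a" "\<And>x. \<bar>a x\<bar> \<le> B" "0 \<le> A"
      "\<And>x y. dist x y < \<rho> \<Longrightarrow> \<bar>a x - a y\<bar> \<le> A * \<Omega> (dist x y)" and xy: "dist x y < \<rho>"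
    have B0: "B \<ge> 0" using a(2) abs_ge_zero order_trans by blast
    show "\<bar>L a x - L a y\<bar> \<le> (\<theta> * A + K * B) * \<Omega> (dist x y)"
    proof (cases "x = y")
      case True
      then show ?thesis using modulus_Omega by (simp add: modulus_def)
    next
      case False
      define t where "t = coord x"
      have t: "0 \<le> t" "t < 1" "proj t = x" using coord_range[of x] by (auto simp: t_def proj_coord)
      \<comment> \<open>The nearest lift of \<open>y\<close> pairs each preimage of \<open>x\<close>
        with the preimage of \<open>y\<close> on the same branch.\<close>
      obtain s where s: "proj s = y" "\<bar>s - t\<bar> = dist (proj t) y" using ex_lift_dist .
      define d where "d = \<bar>s - t\<bar>"
      have d: "d = dist x y" "0 < d" "d < \<rho>1" "d < \<rho>2" "d < \<rho>3"
        using s(2) t(3) False xy by (auto simp: d_def \<rho>_def)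
      define dj where "dj j = dist (branch j s) (branch j t)" for j
      have dj: "0 \<le> dj j" "dj j \<le> d" for j using dist_branch_le by (auto simp: dj_def d_def)
      have \<Omega>dj: "\<Omega> (dj j) \<le> \<Omega> d" for j using dj Omega_mono by blast
      obtain j0 where j0: "j0 < q" "dj j0 \<le> \<eta> * d"
        using contr[of t s] t d by (auto simp: d_def dj_def)
      have "\<Omega> (dj j0) \<le> \<Omega> (\<eta> * d)" by (rule Omega_mono[OF dj(1) j0(2)])
      also have "\<dots> \<le> \<theta>0 * \<Omega> d" using d by (intro \<Omega>c)
      finally have \<Omega>j0: "\<Omega> (dj j0) \<le> \<theta>0 * \<Omega> d" .
      have \<Omega>d: "0 \<le> \<Omega> d" using d Omega_nonneg by simp
      have sum\<Omega>: "(\<Sum>j<q. weight j t * \<Omega> (dj j)) \<le> \<theta> * \<Omega> d"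
      proof -
        have "(\<Sum>j<q. weight j t * \<Omega> (dj j)) = weight j0 t * \<Omega> (dj j0) + (\<Sum>j\<in>{..<q} - {j0}. weight j t * \<Omega> (dj j))"
          using j0(1) by (intro sum.remove) auto
        also have "\<dots> \<le> weight j0 t * (\<theta>0 * \<Omega> d) + (\<Sum>j\<in>{..<q} - {j0}. weight j t * \<Omega> d)"
          using \<Omega>j0 \<Omega>dj weight_pos by (intro add_mono sum_mono mult_left_mono) (auto simp: less_imp_le)
        also have "\<dots> = (\<Sum>j<q. weight j t * \<Omega> d) - weight j0 t * ((1 - \<theta>0) * \<Omega> d)"
          using j0(1) by (subst sum.remove[of "{..<q}" j0]) (auto simp: algebra_simps)
        also have "(\<Sum>j<q. weight j t * \<Omega> d) = \<Omega> d" by (simp add: sum_weight flip: sum_distrib_right)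
        also have "\<Omega> d - weight j0 t * ((1 - \<theta>0) * \<Omega> d) \<le> \<Omega> d - w * ((1 - \<theta>0) * \<Omega> d)"
          using weight_ge[of j0 t] \<theta>0 \<Omega>d by (intro diff_left_mono mult_right_mono) auto
        also have "\<dots> = \<theta> * \<Omega> d" by (simp add: \<theta>_def algebra_simps)
        finally show ?thesis .
      qed
      have diff: "L a y - L a x = (\<Sum>j<q. weight j t * (a (branch j s) - a (branch j t)) + (weight j s - weight j t) * a (branch j s))"
        unfolding s(1)[symmetric] t(3)[symmetric] L_proj by (simp add: sum_subtractf[symmetric] algebra_simps)
      have "\<bar>L a y - L a x\<bar> \<le> (\<Sum>j<q. A * (weight j t * \<Omega> (dj j)) + (K0 * \<Omega> d) * B)"
        unfolding diff
      proof (rule order_trans[OF sum_abs sum_mono])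
        fix j
        have 1: "\<bar>weight j t * (a (branch j s) - a (branch j t))\<bar> \<le> A * (weight j t * \<Omega> (dj j))"
        proof -
          have "\<bar>a (branch j s) - a (branch j t)\<bar> \<le> A * \<Omega> (dj j)"
            using dj[of j] d unfolding dj_def by (intro a(4)) (simp add: \<rho>_def)
          then have "weight j t * \<bar>a (branch j s) - a (branch j t)\<bar> \<le> weight j t * (A * \<Omega> (dj j))"
            using weight_pos[of j t] by (intro mult_left_mono) auto
          then show ?thesis using weight_pos[of j t] by (simp add: abs_mult mult.left_commute)
        qed
        have 2: "\<bar>(weight j s - weight j t) * a (branch j s)\<bar> \<le> (K0 * \<Omega> d) * B"
          unfolding abs_mult using wl[of s t j] a(2) d \<rho>1 \<Omega>d B0
          by (intro mult_mono) (auto simp: d_def)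
        show "\<bar>weight j t * (a (branch j s) - a (branch j t)) + (weight j s - weight j t) * a (branch j s)\<bar>
          \<le> A * (weight j t * \<Omega> (dj j)) + (K0 * \<Omega> d) * B"
          using abs_triangle_ineq 1 2 by (rule order_trans[OF _ add_mono])
      qed
      also have "\<dots> = (\<Sum>j<q. A * (weight j t * \<Omega> (dj j))) + (\<Sum>j<q. (K0 * \<Omega> d) * B)"
        by (rule sum.distrib)
      also have "(\<Sum>j<q. A * (weight j t * \<Omega> (dj j))) = A * (\<Sum>j<q. weight j t * \<Omega> (dj j))"
        by (rule sum_distrib_left[symmetric])
      also have "(\<Sum>j<q. (K0 * \<Omega> d) * B) = K * B * \<Omega> d" by (simp add: K_def)
      also have "A * (\<Sum>j<q. weight j t * \<Omega> (dj j)) + K * B * \<Omega> d \<le> A * (\<theta> * \<Omega> d) + K * B * \<Omega> d"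
        by (rule add_right_mono[OF mult_left_mono[OF sum\<Omega> a(3)]])
      also have "\<dots> = (\<theta> * A + K * B) * \<Omega> d" by (simp add: algebra_simps)
      also have "\<dots> = (\<theta> * A + K * B) * \<Omega> (dist x y)" by (simp only: d(1))
      finally show ?thesis by (simp add: abs_minus_commute)
    qed
  qed
  then show ?thesis using that by blast
qed

section \<open>Full support and vanishing of the variance\<close>

lemma preimage_zero:
  assumes "\<And>x. 0 \<le> c x" "L c (T y) = 0" shows "c y = 0"
proof -
  define t where "t = coord (T y)"
  have t: "proj t = T y" by (simp add: t_def proj_coord)
  then have "y \<in> T -` {proj t}" by simp
  then obtain j where j: "j < q" "y = branch j t" unfolding preimages_eq by blast
  have "(\<Sum>j<q. weight j t * c (branch j t)) = 0" using assms(2) by (simp add: L_proj flip: t)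
  \<comment> \<open>A vanishing sum of nonnegative terms forces every term to vanish.\<close>
  then have "weight j t * c (branch j t) = 0"
    using j(1) assms(1) weight_pos by (subst (asm) sum_nonneg_eq_0_iff) (auto simp: less_imp_le)
  then show ?thesis using weight_pos[of j t] j(2) by simp
qed

text \<open>The common zeros of the iterates \<open>L\<^sup>n c\<close> form a closed nonempty set \<open>S\<close> which contains all
  preimages of its points. Since \<open>T\<close> strictly expands short arcs, a point farthest from \<open>S\<close> would be
  strictly closer to \<open>S\<close> than its image.\<close>

lemma zero_if_integral_zero:
  fixes c :: "circle \<Rightarrow> real"
  assumes c: "continuous_on UNIV c" "\<And>x. 0 \<le> c x" "(\<integral>x. c x \<partial>\<mu>) = 0"
  shows "c x = 0"
proof -
  define S where "S = {x. \<forall>n. (L ^^ n) c x = 0}"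
  have nonneg: "0 \<le> (L ^^ n) c x" for n x
  proof (induction n arbitrary: x)
    case (Suc n)
    then show ?case using L_mono[of "\<lambda>_. 0" "(L ^^ n) c" x] by (simp add: L_const)
  qed (simp add: c)
  have "AE x in \<mu>. (L ^^ n) c x = 0" for n
  proof -
    have "(\<integral>x. (L ^^ n) c x \<partial>\<mu>) = 0" using integral_Ln[OF c(1)] c(3) by simp
    then show ?thesis
      using integral_nonneg_eq_0_iff_AE[OF integrable_continuous[OF continuous_Ln[OF c(1)]]] nonneg by simp
  qed
  \<comment> \<open>Countably many null sets are discarded at once, and a probability measure leaves
    a point outside them, so \<open>S\<close> is nonempty.\<close>
  then have "AE x in \<mu>. \<forall>n. (L ^^ n) c x = 0" by (simp add: AE_all_countable)
  then have "\<exists>x. \<forall>n. (L ^^ n) c x = 0"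
    using eventually_happens'[OF ae_filter_bot] by blast
  then have S_ne: "S \<noteq> {}" by (auto simp: S_def)
  have S_cl: "closed S"
    unfolding S_def Collect_all_eq by (intro closed_INT ballI closed_Collect_eq continuous_Ln c continuous_on_const)
  have backward: "y \<in> S" if "T y \<in> S" for y
  proof -
    have "(L ^^ n) c y = 0" for n
    proof (rule preimage_zero[OF nonneg])
      have "(L ^^ Suc n) c (T y) = 0" using that unfolding S_def by blast
      then show "L ((L ^^ n) c) (T y) = 0" by simp
    qed
    then show ?thesis by (simp add: S_def)
  qed
  obtain z where z: "\<And>x. infdist x S \<le> infdist z S"
    using continuous_attains_sup[OF compact_circle, of "\<lambda>x. infdist x S"] continuous_on_infdist[of UNIV "\<lambda>x. x" S] by auto
  have "infdist z S = 0"
  proof (cases "T z \<in> S")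
    case True
    then show ?thesis using backward by simp
  next
    case False
    have "compact S" using S_cl compact_circle compact_Int_closed[of UNIV S] by simp
    moreover have "continuous_on S (\<lambda>r. dist (T z) r)" by (intro continuous_intros)
    ultimately obtain s where s: "s \<in> S" "\<And>r. r \<in> S \<Longrightarrow> dist (T z) s \<le> dist (T z) r"
      using continuous_attains_inf[of S "\<lambda>r. dist (T z) r"] S_ne by blast
    have "dist (T z) s \<le> infdist (T z) S"
      unfolding infdist_def using S_ne s by (auto intro: cINF_greatest)
    moreover obtain y where y: "T y = s" "dist z y < dist (T z) s"
      using preimage_closer[of s z] False s(1) by metis
    moreover have "infdist z S \<le> dist z y" using backward y(1) s(1) by (intro infdist_le) auto
    ultimately show ?thesis using z[of "T z"] by linarith
  qed
  then have "infdist x S = 0" using z[of x] infdist_nonneg[of x S] by simp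
  then have "x \<in> S" using S_cl S_ne by (simp add: in_closed_iff_infdist_zero)
  then have "(L ^^ 0) c x = 0" unfolding S_def by blast
  then show ?thesis by simp
qed

section \<open>The central limit theorem for regular observables\<close>

theorem central_limit_theorem:
  assumes \<phi>: "\<phi> \<in> C_mod \<Omega>" "\<not> cohomologous_to_constant T \<phi>"
  shows "\<exists>\<gamma>>0. \<forall>b::real.
    (\<lambda>n. measure \<mu> {x. 1 / sqrt (real n) * birkhoff_sum T (\<lambda>y. \<phi> y - (\<integral>z. \<phi> z \<partial>\<mu>)) n x < b})
      \<longlonglongrightarrow> 1 / (\<gamma> * sqrt (2 * pi)) * (LINT t:{..b}|lborel. exp (- (t\<^sup>2) / (2 * \<gamma>\<^sup>2)))"
proof -
  define I where "I = (\<integral>z. \<phi> z \<partial>\<mu>)"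
  define a where "a y = \<phi> y - I" for y
  have c\<phi>: "continuous_on UNIV \<phi>" using \<phi>(1) by (simp add: C_mod_def)
  have ca: "continuous_on UNIV a" unfolding a_def by (intro continuous_intros c\<phi>)
  have a0: "(\<integral>x. a x \<partial>\<mu>) = 0"
    unfolding a_def by (subst Bochner_Integration.integral_diff)
      (auto intro!: integrable_continuous c\<phi> simp: I_def prob_space)
  obtain \<rho> \<theta> K where "lasota_yorke \<mu> T L \<Omega> \<rho> \<theta> K" using lasota_yorke .
  then interpret ly: lasota_yorke \<mu> T L \<Omega> \<rho> \<theta> K .
  obtain A where A: "A \<ge> 0" "\<And>x y. \<bar>\<phi> x - \<phi> y\<bar> \<le> A * \<Omega> (dist x y)"
    using C_mod_bound[OF \<phi>(1) modulus_Omega] by metis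
  obtain M where M: "\<And>x. \<bar>a x\<bar> \<le> M" using continuous_bounded[OF ca] by auto
  have "ly.regular A M a" using ca A M by (auto simp: ly.regular_def a_def)
  from ly.martingale_decomposition[OF this a0]
  obtain u where u: "continuous_on UNIV u" "L (\<lambda>x. a x + u x - u (T x)) = (\<lambda>_. 0)" by metis
  define \<psi> where "\<psi> x = a x + u x - u (T x)" for x
  have c\<psi>: "continuous_on UNIV \<psi>"
    unfolding \<psi>_def by (intro continuous_intros ca u continuous_on_compose2[OF u(1) cont_T]) auto
  interpret ker: transfer_kernel_element \<mu> T L \<psi>
    by unfold_locales (use c\<psi> u(2) in \<open>simp_all add: \<psi>_def[abs_def]\<close>)
  have "ker.v \<noteq> 0"
  proof
    assume v: "ker.v = 0"
    \<comment> \<open>Zero variance makes the continuous function \<open>\<psi>\<close> vanish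
      everywhere, not only almost everywhere; \<open>\<phi>\<close> is then a coboundary of
      \<open>-u\<close> plus its mean.\<close>
    have "(\<psi> x)\<^sup>2 = 0" for x
      by (rule zero_if_integral_zero) (use v in \<open>auto simp: ker.v_def intro!: continuous_intros c\<psi>\<close>)
    then have "\<psi> x = 0" for x by simp
    then have "\<phi> x = - u x - (- u (T x)) + I" for x
      unfolding \<psi>_def a_def by (simp add: algebra_simps)
    then have "cohomologous_to_constant T \<phi>"
      unfolding cohomologous_to_constant_def by (intro exI[of _ "\<lambda>x. - u x"] exI[of _ I]) (auto intro: continuous_intros u)
    with \<phi>(2) show False by simp
  qed
  moreover have "ker.v \<ge> 0" by (simp add: ker.v_def)
  ultimately have v: "ker.v > 0" by simp
  have "a x = \<psi> x - u x + u (T x)" for x by (simp add: \<psi>_def)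
  from ker.central_limit[OF u(1) this v] v show ?thesis
    unfolding I_def[symmetric] a_def[symmetric] by (intro exI[of _ "sqrt ker.v"]) auto
qed

end

theorem theorem4:
  fixes V \<omega> \<Omega> :: "real \<Rightarrow> real" and T :: "circle \<Rightarrow> circle"
    and f h \<phi> :: "circle \<Rightarrow> real" and \<kappa> :: real and \<nu> \<mu> :: "circle measure"
  assumes "admissible V" and "T = circle_map V"
    and "modulus \<omega>" and "modulus \<Omega>" and "compatible T \<Omega> \<omega>"
    and "concave_on {0..} \<Omega>" and "vanishes_orderly \<Omega>"
    and "f \<in> C_mod \<omega>"
    and "RPF_data T f \<Omega> \<kappa> h \<nu>"
    and "\<mu> = density \<nu> (\<lambda>x. ennreal (h x))" and "equilibrium_state T f \<mu>"
    and "\<phi> \<in> C_mod \<Omega>" and "\<not> cohomologous_to_constant T \<phi>"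
  shows "\<exists>\<gamma>>0. \<forall>b::real.
    (\<lambda>n. measure \<mu> {x. 1 / sqrt (real n) *
            birkhoff_sum T (\<lambda>y. \<phi> y - (\<integral>z. \<phi> z \<partial>\<mu>)) n x < b})
      \<longlonglongrightarrow> 1 / (\<gamma> * sqrt (2 * pi)) * (LINT t:{..b}|lborel. exp (- (t\<^sup>2) / (2 * \<gamma>\<^sup>2)))"
proof -
  obtain G q where "circle_lift G (circle_map V) q"
    using circle_lift_circle_map[OF assms(1)] .
  then interpret circle_equilibrium G T q f h \<omega> \<Omega> \<kappa> \<nu> \<mu>
    using assms by (intro circle_equilibrium.intro circle_equilibrium_axioms.intro)
      (simp_all add: equilibrium_state_def)
  show ?thesis using central_limit_theorem assms(12,13) by blast
qed

end
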